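(* Let $k$ be an odd positive integer. Then $2\pi_n(\mathbb{S}^k)\subset\pi_n^{\mathrm{alg}}(\mathbb{S}^k)$ for all positive integers $n$.
   Context: $\mathbb{S}^n\subset\mathbb{R}^{n+1}$ is the standard unit sphere with its usual real algebraic structure, with base point $e=(1,0,\dots,0)$. A map $f:X\to Y$ between real algebraic sets $X\subset\mathbb{R}^a$, $Y\subset\mathbb{R}^b$ is regular if each of its components can be written as $P/Q$ on $X$, with $P,Q$ real polynomials and $Q$ nowhere vanishing on $X$. $\pi_n(\mathbb{S}^k)=\pi_n(\mathbb{S}^k,e)$ is the group of homotopy classes of pointed continuous maps $(\mathbb{S}^n,e)\to(\mathbb{S}^k,e)$, and $2\pi_n(\mathbb{S}^k)=\{2\alpha:\alpha\in\pi_n(\mathbb{S}^k)\}$. The set $\pi_n^{\mathrm{alg}}(\mathbb{S}^k)\subset\pi_n(\mathbb{S}^k)$ consists of those classes that have a representative $(\mathbb{S}^n,e)\to(\mathbb{S}^k,e)$ which is a regular map. *)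

theory Defs
  imports "HOL-Analysis.Analysis" "HOL-Homology.Homology"
begin

text \<open>
  Points of \<open>R^m\<close> are the functions \<^typ>\<open>nat \<Rightarrow> real\<close> that vanish from index \<open>m\<close> on, as in
  \<^const>\<open>Euclidean_space\<close>.  The unit sphere of \<open>R^(n+1)\<close>, with coordinates \<open>x 0, \<dots>, x n\<close>,
  is the library's \<open>nsphere n\<close>.
\<close>

subsection \<open>Regular maps\<close>

text \<open>Polynomial functions in the variables \<open>x 0, \<dots>, x (m-1)\<close>; this mirrors
  \<^const>\<open>real_polynomial_function\<close>, whose domain has to be a normed space.\<close>

inductive polynomial_fun :: "nat \<Rightarrow> ((nat \<Rightarrow> real) \<Rightarrow> real) \<Rightarrow> bool" for m :: nat where
  var: "i < m \<Longrightarrow> polynomial_fun m (\<lambda>x. x i)"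
| const: "polynomial_fun m (\<lambda>x. c)"
| add: "polynomial_fun m P \<Longrightarrow> polynomial_fun m Q \<Longrightarrow> polynomial_fun m (\<lambda>x. P x + Q x)"
| mult: "polynomial_fun m P \<Longrightarrow> polynomial_fun m Q \<Longrightarrow> polynomial_fun m (\<lambda>x. P x * Q x)"

definition regular_map ::
    "nat \<Rightarrow> (nat \<Rightarrow> real) set \<Rightarrow> nat \<Rightarrow> (nat \<Rightarrow> real) set \<Rightarrow> ((nat \<Rightarrow> real) \<Rightarrow> (nat \<Rightarrow> real)) \<Rightarrow> bool"
  where "regular_map a X b Y f \<longleftrightarrow>
    f \<in> X \<rightarrow> Y \<and>
    (\<forall>j<b. \<exists>P Q. polynomial_fun a P \<and> polynomial_fun a Q \<and>
                 (\<forall>x\<in>X. Q x \<noteq> 0 \<and> f x j = P x / Q x))"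

subsection \<open>Homotopy groups of spheres\<close>

definition sphere_base :: "nat \<Rightarrow> real"
  where "sphere_base = (\<lambda>i. if i = 0 then 1 else 0)"

definition pointed_sphere_maps :: "nat \<Rightarrow> nat \<Rightarrow> ((nat \<Rightarrow> real) \<Rightarrow> (nat \<Rightarrow> real)) set"
  where "pointed_sphere_maps n k =
    {f. continuous_map (nsphere n) (nsphere k) f \<and> f sphere_base = sphere_base}"

definition pointed_homotopy ::
    "nat \<Rightarrow> nat \<Rightarrow> (((nat \<Rightarrow> real) \<Rightarrow> (nat \<Rightarrow> real)) \<times> ((nat \<Rightarrow> real) \<Rightarrow> (nat \<Rightarrow> real))) set"
  where "pointed_homotopy n k =
    {(f, g). homotopic_with (\<lambda>h. h sphere_base = sphere_base) (nsphere n) (nsphere k) f g}"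

text \<open>The set \<open>\<pi>_n(S^k)\<close>.  The values of a map off the sphere are unconstrained, but maps that agree
  on the sphere are homotopic, so they do not affect the classes.\<close>

definition homotopy_classes :: "nat \<Rightarrow> nat \<Rightarrow> ((nat \<Rightarrow> real) \<Rightarrow> (nat \<Rightarrow> real)) set set"
  where "homotopy_classes n k = pointed_sphere_maps n k // pointed_homotopy n k"

text \<open>
  The group law for \<open>n \<ge> 1\<close> comes from the pinch map \<open>S^n \<rightarrow> S^n \<or> S^n\<close> collapsing the
  equator \<open>x n = 0\<close>, which contains the base point.  The map below sends the equator to the base
  point, and each open hemisphere homeomorphically, with degree \<open>+1\<close>, onto the complement of the
  base point.  Indeed, the rotation by \<open>\<pi>\<close> of the \<open>(x 0, x n)\<close>-plane
  exchanges the hemispheres without changing the value, and at the north pole \<open>e_n\<close> the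
  derivative is twice the map with \<open>e_0 \<mapsto> e_n\<close> and \<open>e_i \<mapsto> e_i\<close> for \<open>0 < i < n\<close>, which takes
  the positively oriented frame \<open>((-1)^n e_0, e_1, \<dots>, e_(n-1))\<close> at \<open>e_n\<close> to the positively
  oriented frame \<open>((-1)^n e_n, e_1, \<dots>, e_(n-1))\<close> at \<open>-e_0\<close>.
  For \<open>n = 1\<close> the map is the angle doubling \<open>z \<mapsto> z^2\<close>, and the law is the
  concatenation of loops.
\<close>

definition sphere_pinch :: "nat \<Rightarrow> (nat \<Rightarrow> real) \<Rightarrow> (nat \<Rightarrow> real)"
  where "sphere_pinch n x =
    (\<lambda>i. if i = 0 then 1 - 2 * (x n)\<^sup>2
         else if i < n then 2 * \<bar>x n\<bar> * x i
         else if i = n then 2 * x n * x 0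
         else 0)"

definition sphere_map_add ::
    "nat \<Rightarrow> ((nat \<Rightarrow> real) \<Rightarrow> (nat \<Rightarrow> real)) \<Rightarrow> ((nat \<Rightarrow> real) \<Rightarrow> (nat \<Rightarrow> real)) \<Rightarrow>
      ((nat \<Rightarrow> real) \<Rightarrow> (nat \<Rightarrow> real))"
  where "sphere_map_add n f g =
    (\<lambda>x. if 0 \<le> x n then f (sphere_pinch n x) else g (sphere_pinch n x))"

definition homotopy_class_add ::
    "nat \<Rightarrow> nat \<Rightarrow> ((nat \<Rightarrow> real) \<Rightarrow> (nat \<Rightarrow> real)) set \<Rightarrow> ((nat \<Rightarrow> real) \<Rightarrow> (nat \<Rightarrow> real)) set \<Rightarrow>
      ((nat \<Rightarrow> real) \<Rightarrow> (nat \<Rightarrow> real)) set"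
  where "homotopy_class_add n k \<alpha> \<beta> =
    (\<Union>f\<in>\<alpha>. \<Union>g\<in>\<beta>. pointed_homotopy n k `` {sphere_map_add n f g})"

definition twice_homotopy_classes :: "nat \<Rightarrow> nat \<Rightarrow> ((nat \<Rightarrow> real) \<Rightarrow> (nat \<Rightarrow> real)) set set"
  where "twice_homotopy_classes n k =
    {homotopy_class_add n k \<alpha> \<alpha> | \<alpha>. \<alpha> \<in> homotopy_classes n k}"

definition algebraic_homotopy_classes :: "nat \<Rightarrow> nat \<Rightarrow> ((nat \<Rightarrow> real) \<Rightarrow> (nat \<Rightarrow> real)) set set"
  where "algebraic_homotopy_classes n k =
    {\<alpha> \<in> homotopy_classes n k.
      \<exists>f\<in>\<alpha>. regular_map (Suc n) (topspace (nsphere n)) (Suc k) (topspace (nsphere k)) f}"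

subsection \<open>The sum of homotopy classes is well defined\<close>

lemma sphere_base_in_nsphere: "sphere_base \<in> topspace (nsphere n)"
  using in_topspace_nsphere by (simp add: sphere_base_def)

lemma pointed_homotopy_refl_iff:
  "(f, f) \<in> pointed_homotopy n k \<longleftrightarrow> f \<in> pointed_sphere_maps n k"
  by (simp add: pointed_homotopy_def pointed_sphere_maps_def)

lemma equiv_pointed_homotopy: "equiv (pointed_sphere_maps n k) (pointed_homotopy n k)"
proof (rule equivI)
  show "pointed_homotopy n k \<subseteq> pointed_sphere_maps n k \<times> pointed_sphere_maps n k"
    by (auto simp: pointed_homotopy_def pointed_sphere_maps_def
        dest: homotopic_with_imp_continuous_maps homotopic_with_imp_property)
  show "refl_on (pointed_sphere_maps n k) (pointed_homotopy n k)"
    by (simp add: refl_on_def pointed_homotopy_refl_iff)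
  show "sym (pointed_homotopy n k)"
    by (auto simp: pointed_homotopy_def intro!: symI dest: homotopic_with_symD)
  show "trans (pointed_homotopy n k)"
    by (auto simp: pointed_homotopy_def intro!: transI dest: homotopic_with_trans)
qed

lemma sphere_pinch_base:
  assumes "x n = 0"
  shows "sphere_pinch n x = sphere_base"
  using assms by (auto simp: sphere_pinch_def sphere_base_def fun_eq_iff)

lemma sphere_pinch_in_nsphere:
  assumes n: "n > 0" and x: "x \<in> topspace (nsphere n)"
  shows "sphere_pinch n x \<in> topspace (nsphere n)"
proof -
  obtain m where m: "n = Suc m"
    using n gr0_conv_Suc by blast
  have eq: "(\<Sum>i\<le>n. f i) = f 0 + (\<Sum>i<m. f (Suc i)) + f n" for f :: "nat \<Rightarrow> real"
    by (simp add: m sum.atMost_shift del: sum.atMost_Suc)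
  have one: "(x 0)\<^sup>2 + (\<Sum>i<m. (x (Suc i))\<^sup>2) + (x n)\<^sup>2 = 1"
    using x eq [of "\<lambda>i. (x i)\<^sup>2"] by (simp add: nsphere)
  have "(\<Sum>i<m. (sphere_pinch n x (Suc i))\<^sup>2) = (\<Sum>i<m. 4 * (x n)\<^sup>2 * (x (Suc i))\<^sup>2)"
    by (rule sum.cong) (auto simp: sphere_pinch_def m power_mult_distrib)
  also have "\<dots> = 4 * (x n)\<^sup>2 * (1 - (x 0)\<^sup>2 - (x n)\<^sup>2)"
    using one by (simp add: sum_distrib_left [symmetric])
  finally have "(\<Sum>i\<le>n. (sphere_pinch n x i)\<^sup>2)
      = (1 - 2 * (x n)\<^sup>2)\<^sup>2 + 4 * (x n)\<^sup>2 * (1 - (x 0)\<^sup>2 - (x n)\<^sup>2) + (2 * x n * x 0)\<^sup>2"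
    using n by (subst eq) (simp add: sphere_pinch_def)
  also have "\<dots> = 1"
    by (simp add: power2_eq_square algebra_simps)
  finally have "(\<Sum>i\<le>n. (sphere_pinch n x i)\<^sup>2) = 1" .
  moreover have "\<forall>i>n. sphere_pinch n x i = 0"
    by (simp add: sphere_pinch_def)
  ultimately show ?thesis
    by (simp add: nsphere)
qed

lemma continuous_map_sphere_pinch:
  assumes "n > 0"
  shows "continuous_map (nsphere n) (nsphere n) (sphere_pinch n)"
proof -
  have "continuous_map (nsphere n) euclideanreal (\<lambda>x. sphere_pinch n x i)" for i
  proof -
    note [continuous_intros] = continuous_map_nsphere_projection
    show ?thesis
      unfolding sphere_pinch_def by (cases "i = 0"; cases "i < n"; cases "i = n"; simp)
        (intro continuous_intros)+
  qed
  then have "continuous_map (nsphere n) (powertop_real UNIV) (sphere_pinch n)"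
    by (simp add: continuous_map_componentwise_UNIV)
  then show ?thesis
    using sphere_pinch_in_nsphere [OF assms]
    by (subst (2) nsphere) (auto simp: continuous_map_in_subtopology nsphere)
qed

lemma sphere_map_add_homotopy:
  assumes n: "n > 0"
    and ff: "(f, f') \<in> pointed_homotopy n k" and gg: "(g, g') \<in> pointed_homotopy n k"
  shows "(sphere_map_add n f g, sphere_map_add n f' g') \<in> pointed_homotopy n k"
proof -
  let ?I = "top_of_set {0..1::real}"
  let ?X = "prod_topology ?I (nsphere n)"
  let ?q = "\<lambda>z. (fst z, sphere_pinch n (snd z))"
  obtain u where u: "continuous_map ?X (nsphere k) u"
      "\<And>x. u (0, x) = f x" "\<And>x. u (1, x) = f' x"
      "\<And>t. t \<in> {0..1} \<Longrightarrow> u (t, sphere_base) = sphere_base"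
    using ff by (auto simp: pointed_homotopy_def homotopic_with_def)
  obtain v where v: "continuous_map ?X (nsphere k) v"
      "\<And>x. v (0, x) = g x" "\<And>x. v (1, x) = g' x"
      "\<And>t. t \<in> {0..1} \<Longrightarrow> v (t, sphere_base) = sphere_base"
    using gg by (auto simp: pointed_homotopy_def homotopic_with_def)
  have q: "continuous_map ?X ?X ?q"
    by (auto intro!: continuous_map_pairedI continuous_map_fst
        continuous_map_compose [OF continuous_map_snd continuous_map_sphere_pinch [OF n], unfolded o_def])
  define w where "w = (\<lambda>z. if 0 \<le> snd z n then u (?q z) else v (?q z))"
  have "continuous_map ?X (nsphere k) w"
    unfolding w_def
  proof (rule continuous_map_cases_le)
    show "continuous_map ?X euclideanreal (\<lambda>z. snd z n)"
      using continuous_map_compose [OF continuous_map_snd continuous_map_nsphere_projection]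
      by (simp add: o_def)
    show "continuous_map (subtopology ?X S) (nsphere k) (\<lambda>z. u (?q z))"
      "continuous_map (subtopology ?X S) (nsphere k) (\<lambda>z. v (?q z))" for S
      using continuous_map_compose [OF q u(1)] continuous_map_compose [OF q v(1)]
      by (auto simp: o_def intro: continuous_map_from_subtopology)
    show "u (?q z) = v (?q z)" if "z \<in> topspace ?X" "0 = snd z n" for z
      using that u(4) v(4) sphere_pinch_base [of "snd z" n] by auto
  qed auto
  moreover have "w (0, x) = sphere_map_add n f g x" "w (1, x) = sphere_map_add n f' g' x" for x
    by (simp_all add: w_def sphere_map_add_def u v)
  moreover have "w (t, sphere_base) = sphere_base" if "t \<in> {0..1}" for t
  proof -
    have "sphere_base n = 0"
      using n by (simp add: sphere_base_def)
    then show ?thesis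
      using that u(4) sphere_pinch_base [of sphere_base n] by (simp add: w_def)
  qed
  ultimately show ?thesis
    unfolding pointed_homotopy_def homotopic_with_def by blast
qed

lemma homotopy_class_add_eq:
  assumes n: "n > 0" and f: "f \<in> pointed_sphere_maps n k" and g: "g \<in> pointed_sphere_maps n k"
  shows "homotopy_class_add n k (pointed_homotopy n k `` {f}) (pointed_homotopy n k `` {g})
    = pointed_homotopy n k `` {sphere_map_add n f g}"
proof -
  have "(\<lambda>f g. pointed_homotopy n k `` {sphere_map_add n f g})
      respects2 pointed_homotopy n k"
    by (auto intro!: congruent2I' equiv_class_eq [OF equiv_pointed_homotopy]
        sphere_map_add_homotopy [OF n])
  from UN_equiv_class2 [OF equiv_pointed_homotopy equiv_pointed_homotopy this f g]
  show ?thesis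
    by (simp add: homotopy_class_add_def)
qed

lemma homotopy_class_add_closed:
  assumes n: "n > 0" and "\<alpha> \<in> homotopy_classes n k" "\<beta> \<in> homotopy_classes n k"
  shows "homotopy_class_add n k \<alpha> \<beta> \<in> homotopy_classes n k"
proof -
  obtain f g where fg: "f \<in> pointed_sphere_maps n k" "\<alpha> = pointed_homotopy n k `` {f}"
      "g \<in> pointed_sphere_maps n k" "\<beta> = pointed_homotopy n k `` {g}"
    using assms(2,3) unfolding homotopy_classes_def by (auto elim!: quotientE)
  have "sphere_map_add n f g \<in> pointed_sphere_maps n k"
    using sphere_map_add_homotopy [OF n] fg by (metis pointed_homotopy_refl_iff)
  then show ?thesis
    using homotopy_class_add_eq [OF n fg(1,3)] fg
    by (simp add: homotopy_classes_def quotientI)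
qed

end

theory Submission
  imports Defs
begin

text \<open>
  Write \<open>e\<close> for the base point and \<open>R_v\<close> for the half turn \<open>z \<mapsto> 2 <v,z> v / <v,v> - z\<close>.  Let \<open>h\<close> be a
  map of the disc \<open>D\<close> to \<open>S^k\<close> with \<open>h = e\<close> on the boundary.  It lifts to a map \<open>S\<close> from \<open>D\<close> to the
  rotations with \<open>S e = h\<close>: join the points of a fine broken path by products of two half
  turns.  On the boundary \<open>S\<close> fixes \<open>e\<close>, so that \<open>S^-1 e\<close> is again a map of the disc modulo its
  boundary, and it represents \<open>- [h]\<close>.

  A half turn \<open>R_v\<close> depends only on the line through \<open>v\<close>.  If \<open>v\<close> is approximated by a
  polynomial map, then \<open>R_v\<close> becomes regular, and no square root is needed for a normalization.
  Hence every map built from \<open>e\<close> by half turns \<open>R_v\<close> with continuous \<open>v\<close> is homotopic to a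
  regular one.  The null-homotopic map \<open>z\<close> that is \<open>h\<close> on the upper and the mirror image of \<open>h\<close> on
  the lower hemisphere is of this kind.  So is \<open>p = T e\<close>, where \<open>T\<close> is \<open>S\<close> on the lower hemisphere
  and is deformed to \<open>-1\<close> on the upper one, which is possible in the rotation group for odd \<open>k\<close>.

  The remaining ingredient is a rational map, \<open>difference\<close>, on pairs \<open>(z, p)\<close> of unit vectors other
  than \<open>(-e, e)\<close>; it sends \<open>(e, p)\<close> to \<open>p\<close> and \<open>(z, -e)\<close> to a reflection of \<open>z\<close>, and is homotopic to the
  constant map \<open>e\<close> on the diagonal.  Thus \<open>T^-1 (difference z p)\<close> is \<open>S^-1 e\<close> on the lower
  hemisphere up to homotopy, which represents \<open>[h]\<close> since that hemisphere appears mirrored, and is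
  \<open>R_e h\<close> on the upper hemisphere, where \<open>R_h R_e\<close> turns it into \<open>h\<close>.  The result is \<open>2 [h]\<close>.
\<close>

subsection \<open>Half turns and broken paths on the sphere\<close>

abbreviation sphere_points :: "nat \<Rightarrow> (nat \<Rightarrow> real) set"
  where "sphere_points k \<equiv> topspace (nsphere k)"

definition dot :: "nat \<Rightarrow> (nat \<Rightarrow> real) \<Rightarrow> (nat \<Rightarrow> real) \<Rightarrow> real"
  where "dot k u v = (\<Sum>i\<le>k. u i * v i)"

lemma dot_commute: "dot k u v = dot k v u"
  by (simp add: dot_def mult.commute)

lemma dot_simps:
  "dot k (\<lambda>i. u i + v i) w = dot k u w + dot k v w"
  "dot k w (\<lambda>i. u i + v i) = dot k w u + dot k w v"
  "dot k (\<lambda>i. u i - v i) w = dot k u w - dot k v w"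
  "dot k w (\<lambda>i. u i - v i) = dot k w u - dot k w v"
  "dot k (\<lambda>i. a * u i) w = a * dot k u w"
  "dot k w (\<lambda>i. a * u i) = a * dot k w u"
  "dot k (\<lambda>i. u i / a) w = dot k u w / a"
  "dot k w (\<lambda>i. u i / a) = dot k w u / a"
  "dot k (\<lambda>i. - u i) w = - dot k u w"
  "dot k w (\<lambda>i. - u i) = - dot k w u"
  by (simp_all add: dot_def algebra_simps sum.distrib sum_subtractf sum_distrib_left
      sum_divide_distrib sum_negf)

lemma dot_base [simp]: "dot k sphere_base v = v 0" "dot k v sphere_base = v 0"
  by (simp_all add: dot_def sphere_base_def if_distrib [of "\<lambda>x. x * _"] if_distrib [of "\<lambda>x. _ * x"] cong: if_cong)

lemma dot_self_nonneg: "0 \<le> dot k v v"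
  by (simp add: dot_def sum_nonneg)

lemma dot_self_eq_0: "dot k v v = 0 \<longleftrightarrow> (\<forall>i\<le>k. v i = 0)"
  by (auto simp: dot_def sum_nonneg_eq_0_iff)

lemma sphere_points_iff: "x \<in> sphere_points k \<longleftrightarrow> dot k x x = 1 \<and> (\<forall>i>k. x i = 0)"
  by (simp add: nsphere dot_def power2_eq_square)

lemma sphere_base_values [simp]: "sphere_base 0 = 1" "i > 0 \<Longrightarrow> sphere_base i = 0"
  by (simp_all add: sphere_base_def)

lemma sphere_dot_ge:
  assumes "x \<in> sphere_points k" "y \<in> sphere_points k"
  shows "-1 \<le> dot k x y"
  using dot_self_nonneg [of k "\<lambda>i. x i + y i"] assms
  by (simp add: dot_simps sphere_points_iff dot_commute [of k y x])

lemma sphere_dot_le: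
  assumes "x \<in> sphere_points k" "y \<in> sphere_points k"
  shows "dot k x y \<le> 1"
  using dot_self_nonneg [of k "\<lambda>i. x i - y i"] assms
  by (simp add: dot_simps sphere_points_iff dot_commute [of k y x])

definition half_turn :: "nat \<Rightarrow> (nat \<Rightarrow> real) \<Rightarrow> (nat \<Rightarrow> real) \<Rightarrow> (nat \<Rightarrow> real)"
  where "half_turn k v z = (\<lambda>i. 2 * dot k v z / dot k v v * v i - z i)"

lemma dot_half_turn:
  assumes "dot k v v \<noteq> 0"
  shows "dot k (half_turn k v z) (half_turn k v w) = dot k z w"
proof -
  have "dot k (half_turn k v z) (half_turn k v w) =
      2 * dot k v z / dot k v v * (2 * dot k v w / dot k v v * dot k v v) - 2 * dot k v z / dot k v v * dot k v w
      - (2 * dot k v w / dot k v v * dot k z v - dot k z w)"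
    unfolding half_turn_def by (simp only: dot_simps)
  also have "\<dots> = dot k z w"
    using assms by (simp add: dot_commute [of k z v])
  finally show ?thesis .
qed

lemma half_turn_half_turn:
  assumes "dot k v v \<noteq> 0"
  shows "half_turn k v (half_turn k v z) = z"
proof -
  have "dot k v (half_turn k v z) = dot k v z"
    using assms by (simp add: half_turn_def dot_simps)
  then have "half_turn k v (half_turn k v z) = (\<lambda>i. 2 * dot k v z / dot k v v * v i - half_turn k v z i)"
    by (subst half_turn_def) simp
  also have "\<dots> = z"
    unfolding half_turn_def by simp
  finally show ?thesis .
qed

lemma half_turn_in_sphere:
  assumes "dot k v v \<noteq> 0" "\<And>i. i > k \<Longrightarrow> v i = 0" "z \<in> sphere_points k"
  shows "half_turn k v z \<in> sphere_points k"
  using assms dot_half_turn [OF assms(1), of z z]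
  by (simp add: sphere_points_iff) (simp add: half_turn_def)

lemma half_turn_self: "dot k v v \<noteq> 0 \<Longrightarrow> half_turn k v v = v"
  by (auto simp: half_turn_def)

text \<open>For unit vectors the sum spans the bisector of \<open>u\<close> and \<open>v\<close>,
  and the half turn about it exchanges the two. The axis degenerates only for antipodal
  vectors.\<close>

lemma half_turn_mid:
  assumes "u \<in> sphere_points k" "v \<in> sphere_points k" "dot k u v \<noteq> -1"
  shows "half_turn k (\<lambda>i. v i + u i) u = v"
proof -
  have "dot k (\<lambda>i. v i + u i) (\<lambda>i. v i + u i) = 2 * dot k (\<lambda>i. v i + u i) u"
    and "dot k (\<lambda>i. v i + u i) u \<noteq> 0"
    using assms by (auto simp: dot_simps sphere_points_iff dot_commute [of k v u])
  then show ?thesis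
    by (simp add: half_turn_def)
qed

text \<open>Each pair of half turns is the rotation in the plane of \<open>g j\<close> and
  \<open>g (Suc j)\<close> that takes the first to the second. The half turn about
  \<open>g j\<close> is inserted so that a resting path gives the identity.\<close>

fun transport :: "nat \<Rightarrow> (nat \<Rightarrow> nat \<Rightarrow> real) \<Rightarrow> nat \<Rightarrow> (nat \<Rightarrow> real) \<Rightarrow> (nat \<Rightarrow> real)" where
  "transport k g 0 v = v"
| "transport k g (Suc j) v =
    half_turn k (\<lambda>i. g (Suc j) i + g j i) (half_turn k (g j) (transport k g j v))"

text \<open>Half turns are involutions, so the inverse of \<open>transport\<close> is the same
  product in the opposite order.\<close>

fun transport_back :: "nat \<Rightarrow> (nat \<Rightarrow> nat \<Rightarrow> real) \<Rightarrow> nat \<Rightarrow> (nat \<Rightarrow> real) \<Rightarrow> (nat \<Rightarrow> real)" where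
  "transport_back k g 0 v = v"
| "transport_back k g (Suc j) v =
    transport_back k g j (half_turn k (g j) (half_turn k (\<lambda>i. g (Suc j) i + g j i) v))"

text \<open>For antipodal neighbours the axis \<open>g (Suc j) + g j\<close> of the second half turn
  would be zero.\<close>

definition broken_path :: "nat \<Rightarrow> nat \<Rightarrow> (nat \<Rightarrow> nat \<Rightarrow> real) \<Rightarrow> bool"
  where "broken_path k m g \<longleftrightarrow>
    (\<forall>j\<le>m. g j \<in> sphere_points k) \<and> (\<forall>j<m. dot k (g j) (g (Suc j)) \<noteq> -1)"

lemma broken_path_Suc:
  assumes "broken_path k (Suc m) g"
  shows "broken_path k m g" "g m \<in> sphere_points k" "g (Suc m) \<in> sphere_points k"
    "dot k (g m) (g (Suc m)) \<noteq> -1" "dot k (g m) (g m) = 1"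
    "dot k (\<lambda>i. g (Suc m) i + g m i) (\<lambda>i. g (Suc m) i + g m i) \<noteq> 0"
proof -
  show *: "broken_path k m g" "g m \<in> sphere_points k" "g (Suc m) \<in> sphere_points k"
    "dot k (g m) (g (Suc m)) \<noteq> -1"
    using assms by (auto simp: broken_path_def)
  show "dot k (g m) (g m) = 1"
    "dot k (\<lambda>i. g (Suc m) i + g m i) (\<lambda>i. g (Suc m) i + g m i) \<noteq> 0"
    using * by (auto simp: dot_simps sphere_points_iff dot_commute [of k "g (Suc m)" "g m"])
qed

lemma transport_back_transport:
  "broken_path k m g \<Longrightarrow> transport_back k g m (transport k g m v) = v"
proof (induction m arbitrary: v)
  case (Suc m)
  then show ?case
    using broken_path_Suc [OF Suc.prems] by (simp add: half_turn_half_turn)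
qed simp

lemma transport_start: "broken_path k m g \<Longrightarrow> transport k g m (g 0) = g m"
proof (induction m)
  case (Suc m)
  then show ?case
    using broken_path_Suc [OF Suc.prems] by (simp add: half_turn_self half_turn_mid)
qed simp

lemma transport_back_end: "broken_path k m g \<Longrightarrow> transport_back k g m (g m) = g 0"
  by (metis transport_back_transport transport_start)

lemma transport_back_in_sphere:
  "broken_path k m g \<Longrightarrow> v \<in> sphere_points k \<Longrightarrow> transport_back k g m v \<in> sphere_points k"
proof (induction m arbitrary: v)
  case (Suc m)
  have "dot k (g m) (g m) \<noteq> 0" "\<And>i. i > k \<Longrightarrow> g m i = 0"
    "\<And>i. i > k \<Longrightarrow> g (Suc m) i + g m i = 0"
    using broken_path_Suc [OF Suc.prems(1)] by (auto simp: sphere_points_iff)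
  then have "half_turn k (g m) (half_turn k (\<lambda>i. g (Suc m) i + g m i) v) \<in> sphere_points k"
    using broken_path_Suc(6) [OF Suc.prems(1)] Suc.prems(2) by (intro half_turn_in_sphere)
  then show ?case
    using broken_path_Suc(1) [OF Suc.prems(1)] Suc.IH by simp
qed simp

text \<open>Each step consists of half turns about \<open>u\<close> and \<open>2 u\<close>, which
  cancel. Hence the lift is trivial wherever a path stays at one point.\<close>

lemma transport_constant:
  assumes "u \<in> sphere_points k" "\<And>j. j \<le> m \<Longrightarrow> g j = u"
  shows "transport k g m v = v" "transport_back k g m v = v"
proof -
  have u: "dot k u u \<noteq> 0"
    using assms(1) by (simp add: sphere_points_iff)
  have double: "half_turn k (\<lambda>i. 2 * u i) w = half_turn k u w" for w
    using u by (simp add: half_turn_def dot_simps fun_eq_iff)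
  show "transport k g m v = v"
    using assms(2) by (induction m) (simp_all add: double half_turn_half_turn u)
  show "transport_back k g m v = v"
    using assms(2) by (induction m arbitrary: v) (simp_all add: double half_turn_half_turn u)
qed



text \<open>For unit vectors \<open>z\<close> and \<open>p\<close> let \<open>D\<close> be the conformal map of the sphere that fixes \<open>e\<close> and
  \<open>-e\<close> and scales by \<open>(1 - p 0) / 2\<close> in the stereographic projection from \<open>-e\<close>, and \<open>C\<close> the
  reflection in the hyperplane orthogonal to \<open>p - e\<close>.  Then \<open>difference k z p\<close> is
  \<open>C (D z)\<close>.  The reflection \<open>C\<close> is undefined at \<open>p = e\<close>, but the scaling factor cancels its
  denominator, so that only the point \<open>z = -e\<close>, \<open>p = e\<close> has to be excluded.\<close>

definition difference :: "nat \<Rightarrow> (nat \<Rightarrow> real) \<Rightarrow> (nat \<Rightarrow> real) \<Rightarrow> (nat \<Rightarrow> real)"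
  where "difference k z p = (\<lambda>i.
    ((1 + z 0 - ((1 - p 0) / 2)\<^sup>2 * (1 - z 0)) * p i
      + (1 - p 0) * (z i - z 0 * sphere_base i)
      - (dot k p z - z 0 * p 0) * (p i - sphere_base i))
    / (1 + z 0 + ((1 - p 0) / 2)\<^sup>2 * (1 - z 0)))"


lemma difference_denominator_pos:
  assumes "z \<in> sphere_points k" "p \<in> sphere_points k" "\<not> (z 0 = -1 \<and> p 0 = 1)"
  shows "1 + z 0 + ((1 - p 0) / 2)\<^sup>2 * (1 - z 0) > 0"
proof -
  have "-1 \<le> z 0" "z 0 \<le> 1"
    using sphere_dot_ge [of z k sphere_base] sphere_dot_le [of z k sphere_base] assms(1)
      sphere_base_in_nsphere by auto
  then show ?thesis
    using assms(3) by (cases "z 0 = -1") (auto simp: add_pos_nonneg)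
qed

lemma dot_difference:
  fixes z p w :: "nat \<Rightarrow> real"
  shows "dot k (difference k z p) w =
    ((1 + z 0 - ((1 - p 0) / 2)\<^sup>2 * (1 - z 0)) * dot k p w
      + (1 - p 0) * (dot k z w - z 0 * w 0)
      - (dot k p z - z 0 * p 0) * (dot k p w - w 0))
    / (1 + z 0 + ((1 - p 0) / 2)\<^sup>2 * (1 - z 0))"
  by (simp add: difference_def dot_simps)

lemma difference_in_sphere:
  assumes z: "z \<in> sphere_points k" and p: "p \<in> sphere_points k" and zp: "\<not> (z 0 = -1 \<and> p 0 = 1)"
  shows "difference k z p \<in> sphere_points k"
proof -
  \<comment> \<open>\<open>n / d\<close> is coordinate \<open>0\<close> of the conformal image
    \<open>D z\<close>, \<open>(1 - p 0) / d\<close> is the factor on its other coordinates, and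
    \<open>s\<close> is the inner product of \<open>p\<close> and \<open>z\<close> without
    coordinate \<open>0\<close>.\<close>
  define d where "d = 1 + z 0 + ((1 - p 0) / 2)\<^sup>2 * (1 - z 0)"
  define n where "n = 1 + z 0 - ((1 - p 0) / 2)\<^sup>2 * (1 - z 0)"
  define s where "s = dot k p z - z 0 * p 0"
  have d: "d \<noteq> 0"
    using difference_denominator_pos [OF z p zp] by (simp add: d_def)
  have dot: "dot k (difference k z p) w =
      (n * dot k p w + (1 - p 0) * (dot k z w - z 0 * w 0) - s * (dot k p w - w 0)) / d" for w
    by (simp add: dot_difference n_def d_def s_def)
  have zz: "dot k z z = 1" and pp: "dot k p p = 1"
    using z p by (simp_all add: sphere_points_iff)
  have N0: "difference k z p 0 = (n * p 0 - s * (p 0 - 1)) / d"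
    using dot [of sphere_base] by simp
  have Np: "dot k p (difference k z p) = (n + (1 - p 0) * s - s * (1 - p 0)) / d"
    using dot [of p] by (simp add: dot_commute [of k "difference k z p" p] dot_commute [of k z p] pp s_def)
  have Nz: "dot k z (difference k z p) =
      (n * dot k p z + (1 - p 0) * (1 - (z 0)\<^sup>2) - s * (dot k p z - z 0)) / d"
    using dot [of z] by (simp add: dot_commute [of k "difference k z p" z] zz power2_eq_square)
  have pz: "dot k p z = s + z 0 * p 0"
    by (simp add: s_def)
  \<comment> \<open>The right-hand side is \<open>d^2\<close> times the squared norm of
    \<open>D z\<close>, which the reflection does not change.\<close>
  have "dot k (difference k z p) (difference k z p) * d\<^sup>2 = n\<^sup>2 + (1 - p 0)\<^sup>2 * (1 - (z 0)\<^sup>2)"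
    unfolding dot [of "difference k z p"] N0 Np Nz pz using d
    by (simp add: field_simps power2_eq_square)
  also have "\<dots> = d\<^sup>2"
    by (simp add: n_def d_def power2_eq_square field_simps)
  finally have "dot k (difference k z p) (difference k z p) = 1"
    using d by simp
  moreover have "difference k z p i = 0" if "i > k" for i
    using that z p by (simp add: difference_def sphere_points_iff)
  ultimately show ?thesis
    by (simp add: sphere_points_iff)
qed

text \<open>The fraction reduces to \<open>2 p / 2\<close>; geometrically, \<open>D\<close> fixes
  the base point and the reflection takes it to \<open>p\<close>.\<close>

lemma difference_base_left: "difference k sphere_base p = p"
  by (auto simp: difference_def)

text \<open>Here the scaling factor is \<open>1\<close>, so that \<open>D\<close> is the identity
  and only the reflection orthogonal to the base point is left.\<close>

lemma difference_antipode_right: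
  "difference k z (\<lambda>i. - sphere_base i) = (\<lambda>i. z i - 2 * z 0 * sphere_base i)"
proof -
  have "dot k (\<lambda>i. - sphere_base i) z = - z 0"
    by (simp add: dot_simps)
  then show ?thesis
    by (auto simp: difference_def fun_eq_iff field_simps)
qed

text \<open>This allows the values on the diagonal to be contracted to the base point along great
  arcs.\<close>

lemma difference_diagonal_ne_antipode:
  assumes z: "z \<in> sphere_points k"
  shows "difference k z z 0 \<noteq> -1"
proof
  assume *: "difference k z z 0 = -1"
  have b: "-1 \<le> z 0" "z 0 \<le> 1"
    using sphere_dot_ge [of z k sphere_base] sphere_dot_le [of z k sphere_base] z
      sphere_base_in_nsphere by auto
  have zz: "dot k z z = 1"
    using z by (simp add: sphere_points_iff)
  define d where "d = 1 + z 0 + ((1 - z 0) / 2)\<^sup>2 * (1 - z 0)"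
  have d: "d > 0"
    using difference_denominator_pos [OF z z] by (auto simp: d_def)
  define x where "x = (1 + z 0 - ((1 - z 0) / 2)\<^sup>2 * (1 - z 0)) * z 0
      - (1 - z 0 * z 0) * (z 0 - 1)"
  have "difference k z z 0 = x / d"
    using dot_difference [of k z z sphere_base] by (simp add: d_def x_def zz)
  then have "x = - d"
    using d * by (simp add: eq_divide_eq)
  \<comment> \<open>Clearing the denominator leaves three nonnegative terms; the first vanishes only
    for \<open>z 0 = -1\<close>, the second only for \<open>z 0 = 1\<close>.\<close>
  then have "(1 + z 0)\<^sup>2 + ((1 - z 0) / 2)\<^sup>2 * (1 - z 0)\<^sup>2 + (1 - (z 0)\<^sup>2) * (1 - z 0) = 0"
    by (simp add: x_def d_def power2_eq_square field_simps)
  moreover have "(1 - (z 0)\<^sup>2) * (1 - z 0) \<ge> 0"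
    using b by (simp add: abs_square_le_1)
  moreover have "((1 - z 0) / 2)\<^sup>2 * (1 - z 0)\<^sup>2 \<ge> 0" "(1 + z 0)\<^sup>2 \<ge> 0"
    by simp_all
  ultimately have "(1 + z 0)\<^sup>2 = 0" "((1 - z 0) / 2)\<^sup>2 * (1 - z 0)\<^sup>2 = 0"
    by linarith+
  then show False
    by auto
qed

text \<open>The half-angle parametrization of the rotations \<open>cos t + sin t J\<close> keeps the entries rational.\<close>

definition complex_rotation :: "real \<Rightarrow> real \<Rightarrow> (nat \<Rightarrow> real) \<Rightarrow> (nat \<Rightarrow> real)"
  where "complex_rotation a b v = (\<lambda>i.
    ((a\<^sup>2 - b\<^sup>2) * v i + 2 * a * b * (if even i then - v (Suc i) else v (i - 1))) / (a\<^sup>2 + b\<^sup>2))"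

text \<open>As \<open>k\<close> is odd, the \<open>k + 1\<close> coordinates split into pairs
  \<open>(2 j, 2 j + 1)\<close>, and each pair is rotated by the same angle.\<close>

lemma complex_rotation_in_sphere:
  assumes "odd k" "a\<^sup>2 + b\<^sup>2 \<noteq> 0" "v \<in> sphere_points k"
  shows "complex_rotation a b v \<in> sphere_points k"
proof -
  obtain r where k: "k = Suc (2 * r)"
    using \<open>odd k\<close> by (auto elim: oddE)
  have pairs: "(\<Sum>i\<le>Suc (2 * r). f i) = (\<Sum>j\<le>r. f (2 * j) + f (Suc (2 * j)))" for f :: "nat \<Rightarrow> real"
    by (induction r) auto
  define s where "s = a\<^sup>2 + b\<^sup>2"
  define c where "c = a\<^sup>2 - b\<^sup>2"
  have s: "s \<noteq> 0" "c\<^sup>2 + (2 * a * b)\<^sup>2 = s\<^sup>2"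
    using assms by (simp_all add: s_def c_def power2_eq_square algebra_simps)
  have "((c * x + 2 * a * b * (- y)) / s)\<^sup>2 + ((c * y + 2 * a * b * x) / s)\<^sup>2
      = ((c\<^sup>2 + (2 * a * b)\<^sup>2) / s\<^sup>2) * (x\<^sup>2 + y\<^sup>2)" for x y
    using s(1) by (simp add: power_divide divide_simps) (simp add: power2_eq_square algebra_simps)
  then have "((c * x + 2 * a * b * (- y)) / s)\<^sup>2 + ((c * y + 2 * a * b * x) / s)\<^sup>2 = x\<^sup>2 + y\<^sup>2" for x y
    using s by simp
  then have "dot k (complex_rotation a b v) (complex_rotation a b v) = dot k v v"
    unfolding dot_def k pairs complex_rotation_def c_def s_def
    by (simp add: power2_eq_square)
  moreover have "complex_rotation a b v i = 0" if "i > k" for i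
  proof -
    \<comment> \<open>An odd \<open>i\<close> reads coordinate \<open>i - 1\<close>, which still
      lies beyond \<open>k\<close> because \<open>k\<close> is odd.\<close>
    have "even i \<or> i - 1 > k"
      using that \<open>odd k\<close> by (metis One_nat_def Suc_pred even_Suc less_antisym less_nat_zero_code
          not_gr_zero zero_less_iff_neq_zero)
    then show ?thesis
      using that assms(3) by (auto simp: complex_rotation_def sphere_points_iff)
  qed
  ultimately show ?thesis
    using assms(3) by (simp add: sphere_points_iff)
qed

lemma complex_rotation_inverse:
  assumes "a\<^sup>2 + b\<^sup>2 \<noteq> 0"
  shows "complex_rotation a (- b) (complex_rotation a b v) = v"
proof
  fix i
  have 1: "((a\<^sup>2 - b\<^sup>2) * ((a\<^sup>2 - b\<^sup>2) * x - 2 * a * b * y) / (a\<^sup>2 + b\<^sup>2)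
      + 2 * a * b * ((a\<^sup>2 - b\<^sup>2) * y + 2 * a * b * x) / (a\<^sup>2 + b\<^sup>2)) / (a\<^sup>2 + b\<^sup>2) = x" for x y
    using assms by (simp add: divide_simps) (simp add: power2_eq_square algebra_simps)
  have 2: "((a\<^sup>2 - b\<^sup>2) * ((a\<^sup>2 - b\<^sup>2) * x + 2 * a * b * y) / (a\<^sup>2 + b\<^sup>2)
      - 2 * a * b * ((a\<^sup>2 - b\<^sup>2) * y - 2 * a * b * x) / (a\<^sup>2 + b\<^sup>2)) / (a\<^sup>2 + b\<^sup>2) = x" for x y
    using assms by (simp add: divide_simps) (simp add: power2_eq_square algebra_simps)
  show "complex_rotation a (- b) (complex_rotation a b v) i = v i"
  proof (cases "even i")
    case True
    then show ?thesis
      using 1 [of "v i" "v (Suc i)"] by (simp add: complex_rotation_def)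
  next
    case False
    then obtain j where "i = Suc j" "even j"
      by (metis even_Suc not0_implies_Suc odd_pos less_not_refl)
    then show ?thesis
      using 2 [of "v i" "v j"] by (simp add: complex_rotation_def)
  qed
qed

lemma complex_rotation_simps [simp]:
  "complex_rotation 1 0 v = v" "complex_rotation 0 1 v = (\<lambda>i. - v i)"
  "complex_rotation 0 (-1) v = (\<lambda>i. - v i)"
  by (simp_all add: complex_rotation_def)

subsection \<open>Approximation by regular maps\<close>

lemma nsphere_eq_top_of_set: "nsphere n = top_of_set (sphere_points n)"
  by (simp add: nsphere euclidean_product_topology)

section \<open>Continuity and compactness in the product topology\<close>

lemma continuous_on_eval [continuous_intros]:
  "continuous_on S (\<lambda>x :: nat \<Rightarrow> real. x i)"
  by (rule continuous_on_subset [OF continuous_on_product_coordinates]) simp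

lemma continuous_on_dot [continuous_intros]:
  assumes "continuous_on S u" "continuous_on S v"
  shows "continuous_on S (\<lambda>x. dot k (u x) (v x))"
  unfolding dot_def
  by (intro continuous_intros continuous_on_product_then_coordinatewise [OF assms(1)]
      continuous_on_product_then_coordinatewise [OF assms(2)])

text \<open>Tychonoff's theorem, transferred to the type-class topology on functions.\<close>

lemma compact_cube: "compact {x :: nat \<Rightarrow> real. \<forall>i. x i \<in> {a..b}}"
proof -
  have "compactin (product_topology (\<lambda>i::nat. euclideanreal) UNIV) (PiE UNIV (\<lambda>i. {a..b}))"
    by (simp add: compactin_PiE)
  then show ?thesis
    by (simp add: euclidean_product_topology PiE_UNIV_domain Pi_def)
qed

lemma sphere_points_bounded:
  assumes "x \<in> sphere_points n"
  shows "\<bar>x i\<bar> \<le> 1"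
proof (cases "i \<le> n")
  case True
  have "(x i)\<^sup>2 \<le> (\<Sum>i\<le>n. (x i)\<^sup>2)"
    using True by (intro member_le_sum) auto
  also have "\<dots> = 1"
    using assms by (simp add: nsphere)
  finally show ?thesis
    by (simp add: abs_square_le_1)
next
  case False
  then show ?thesis
    using assms by (simp add: nsphere)
qed

lemma compact_sphere_points: "compact (sphere_points n)"
proof -
  have "closed {x :: nat \<Rightarrow> real. dot n x x = 1}"
    by (intro closed_Collect_eq continuous_intros)
  moreover have "closed {x :: nat \<Rightarrow> real. \<forall>i. i \<le> n \<or> x i = 0}"
    by (intro closed_Collect_all closed_Collect_disj closed_Collect_const closed_Collect_eq
        continuous_intros)
  moreover have "sphere_points n = {x. dot n x x = 1} \<inter> {x. \<forall>i. i \<le> n \<or> x i = 0}"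
    by (auto simp: sphere_points_iff) (metis not_le_imp_less leD)+
  ultimately have "closed (sphere_points n)"
    by (simp add: closed_Int)
  moreover have "sphere_points n \<subseteq> {x. \<forall>i. x i \<in> {-1..1}}"
    using sphere_points_bounded by (force simp: abs_le_iff)
  then have "{x. \<forall>i. x i \<in> {-1..1}} \<inter> sphere_points n = sphere_points n"
    by (rule Int_absorb1)
  ultimately show ?thesis
    using compact_Int_closed [OF compact_cube [of "-1" 1]] by metis
qed

lemma continuous_on_polynomial_fun: "polynomial_fun m P \<Longrightarrow> continuous_on S P"
  by (induction rule: polynomial_fun.induct) (auto intro!: continuous_intros)

text \<open>Stone-Weierstrass: the coordinates up to \<open>n\<close> separate the points of the
  sphere.\<close>

lemma polynomial_fun_dense:
  assumes g: "continuous_on (sphere_points n) g" and "e > 0"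
  obtains P where "polynomial_fun (Suc n) P" "\<And>x. x \<in> sphere_points n \<Longrightarrow> \<bar>g x - P x\<bar> < e"
proof -
  interpret function_ring_on "Collect (polynomial_fun (Suc n))" "sphere_points n"
  proof
    fix x y assume xy: "x \<in> sphere_points n" "y \<in> sphere_points n" "x \<noteq> y"
    then obtain i where "x i \<noteq> y i"
      by blast
    moreover have "i < Suc n"
      using xy calculation by (metis sphere_points_iff not_less_eq)
    ultimately show "\<exists>f\<in>Collect (polynomial_fun (Suc n)). f x \<noteq> f y"
      by (intro bexI [of _ "\<lambda>x. x i"]) (simp_all add: polynomial_fun.var)
  qed (simp_all add: compact_sphere_points continuous_on_polynomial_fun polynomial_fun.intros)
  show ?thesis
    using Stone_Weierstrass_basic [OF assms] that by auto
qed

section \<open>Regular functions on the sphere and uniform limits of them\<close>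

definition regular_function :: "nat \<Rightarrow> ((nat \<Rightarrow> real) \<Rightarrow> real) \<Rightarrow> bool"
  where "regular_function n g \<longleftrightarrow> (\<exists>P Q. polynomial_fun (Suc n) P \<and> polynomial_fun (Suc n) Q \<and>
    (\<forall>x\<in>sphere_points n. Q x \<noteq> 0 \<and> g x = P x / Q x))"

lemma regular_function_polynomial: "polynomial_fun (Suc n) P \<Longrightarrow> regular_function n P"
  unfolding regular_function_def using polynomial_fun.const [of "Suc n" 1] by force

lemma regular_function_add:
  assumes "regular_function n f" "regular_function n g"
  shows "regular_function n (\<lambda>x. f x + g x)"
proof -
  obtain P Q P' Q' where
    "polynomial_fun (Suc n) P" "polynomial_fun (Suc n) Q"
    "polynomial_fun (Suc n) P'" "polynomial_fun (Suc n) Q'"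
    "\<And>x. x \<in> sphere_points n \<Longrightarrow> Q x \<noteq> 0 \<and> f x = P x / Q x"
    "\<And>x. x \<in> sphere_points n \<Longrightarrow> Q' x \<noteq> 0 \<and> g x = P' x / Q' x"
    using assms unfolding regular_function_def by metis
  then show ?thesis
    unfolding regular_function_def
    by (intro exI [of _ "\<lambda>x. P x * Q' x + P' x * Q x"] exI [of _ "\<lambda>x. Q x * Q' x"])
      (auto intro!: polynomial_fun.intros simp: add_frac_eq)
qed

lemma regular_function_mult:
  assumes "regular_function n f" "regular_function n g"
  shows "regular_function n (\<lambda>x. f x * g x)"
proof -
  obtain P Q P' Q' where
    "polynomial_fun (Suc n) P" "polynomial_fun (Suc n) Q"
    "polynomial_fun (Suc n) P'" "polynomial_fun (Suc n) Q'"
    "\<And>x. x \<in> sphere_points n \<Longrightarrow> Q x \<noteq> 0 \<and> f x = P x / Q x"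
    "\<And>x. x \<in> sphere_points n \<Longrightarrow> Q' x \<noteq> 0 \<and> g x = P' x / Q' x"
    using assms unfolding regular_function_def by metis
  then show ?thesis
    unfolding regular_function_def
    by (intro exI [of _ "\<lambda>x. P x * P' x"] exI [of _ "\<lambda>x. Q x * Q' x"])
      (auto intro!: polynomial_fun.intros)
qed

lemma regular_function_inverse:
  assumes "regular_function n f" "\<And>x. x \<in> sphere_points n \<Longrightarrow> f x \<noteq> 0"
  shows "regular_function n (\<lambda>x. inverse (f x))"
proof -
  obtain P Q where
    "polynomial_fun (Suc n) P" "polynomial_fun (Suc n) Q"
    "\<And>x. x \<in> sphere_points n \<Longrightarrow> Q x \<noteq> 0 \<and> f x = P x / Q x"
    using assms unfolding regular_function_def by metis
  then show ?thesis
    unfolding regular_function_def using assms(2)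
    by (intro exI [of _ Q] exI [of _ P]) force
qed

text \<open>The approximants are required to be exact at the base point, so that they stay pointed.\<close>

definition regular_approx ::
    "nat \<Rightarrow> (nat \<Rightarrow> (nat \<Rightarrow> real) \<Rightarrow> real) \<Rightarrow> ((nat \<Rightarrow> real) \<Rightarrow> real) \<Rightarrow> bool"
  where "regular_approx n G g \<longleftrightarrow>
    (\<forall>\<^sub>F r in sequentially. regular_function n (G r) \<and> G r sphere_base = g sphere_base) \<and>
    uniform_limit (sphere_points n) G g sequentially \<and> continuous_on (sphere_points n) g"

named_theorems regular_approx_intros

lemma regular_approx_polynomial:
  assumes "polynomial_fun (Suc n) P"
  shows "regular_approx n (\<lambda>r. P) P"
  using assms
  by (auto simp: regular_approx_def regular_function_polynomial continuous_on_polynomial_fun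
      intro: uniform_limit_const)

lemma regular_approx_const [regular_approx_intros]: "regular_approx n (\<lambda>r x. c) (\<lambda>x. c)"
  by (intro regular_approx_polynomial polynomial_fun.const)

lemma regular_approx_add [regular_approx_intros]:
  assumes "regular_approx n F f" "regular_approx n G g"
  shows "regular_approx n (\<lambda>r x. F r x + G r x) (\<lambda>x. f x + g x)"
  unfolding regular_approx_def
proof (intro conjI)
  show "\<forall>\<^sub>F r in sequentially. regular_function n (\<lambda>x. F r x + G r x) \<and>
      F r sphere_base + G r sphere_base = f sphere_base + g sphere_base"
    using assms unfolding regular_approx_def
    by (auto elim: eventually_elim2 intro: regular_function_add)
qed (use assms in \<open>auto simp: regular_approx_def intro!: uniform_limit_add continuous_intros\<close>)

lemma bounded_regular_approx: "regular_approx n G g \<Longrightarrow> bounded (g ` sphere_points n)"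
  by (simp add: regular_approx_def compact_continuous_image compact_imp_bounded compact_sphere_points)

lemma regular_approx_mult [regular_approx_intros]:
  assumes "regular_approx n F f" "regular_approx n G g"
  shows "regular_approx n (\<lambda>r x. F r x * G r x) (\<lambda>x. f x * g x)"
  unfolding regular_approx_def
proof (intro conjI)
  show "\<forall>\<^sub>F r in sequentially. regular_function n (\<lambda>x. F r x * G r x) \<and>
      F r sphere_base * G r sphere_base = f sphere_base * g sphere_base"
    using assms unfolding regular_approx_def
    by (auto elim: eventually_elim2 intro: regular_function_mult)
  show "uniform_limit (sphere_points n) (\<lambda>r x. F r x * G r x) (\<lambda>x. f x * g x) sequentially"
    using assms bounded_regular_approx [OF assms(1)] bounded_regular_approx [OF assms(2)]
    by (intro uniform_lim_mult) (auto simp: regular_approx_def)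
qed (use assms in \<open>auto simp: regular_approx_def intro!: continuous_intros\<close>)

lemma regular_approx_uminus [regular_approx_intros]:
  "regular_approx n G g \<Longrightarrow> regular_approx n (\<lambda>r x. - G r x) (\<lambda>x. - g x)"
  using regular_approx_mult [OF regular_approx_const [of n "-1"]] by fastforce

lemma regular_approx_diff [regular_approx_intros]:
  assumes "regular_approx n F f" "regular_approx n G g"
  shows "regular_approx n (\<lambda>r x. F r x - G r x) (\<lambda>x. f x - g x)"
  using regular_approx_add [OF assms(1) regular_approx_uminus [OF assms(2)]] by simp

lemma regular_approx_power [regular_approx_intros]:
  "regular_approx n G g \<Longrightarrow> regular_approx n (\<lambda>r x. G r x ^ m) (\<lambda>x. g x ^ m)"
  by (induction m) (auto intro: regular_approx_intros)

lemma regular_approx_sum [regular_approx_intros]: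
  assumes "\<And>i. i \<in> I \<Longrightarrow> regular_approx n (G i) (g i)"
  shows "regular_approx n (\<lambda>r x. \<Sum>i\<in>I. G i r x) (\<lambda>x. \<Sum>i\<in>I. g i x)"
  using assms by (induction I rule: infinite_finite_induct) (auto intro!: regular_approx_intros)

lemma regular_approx_bounded_below:
  assumes "regular_approx n G g" "\<And>x. x \<in> sphere_points n \<Longrightarrow> g x \<noteq> 0"
  obtains b where "b > 0" "\<And>x. x \<in> sphere_points n \<Longrightarrow> b \<le> norm (g x)"
proof -
  have "continuous_on (sphere_points n) (\<lambda>x. norm (g x))"
    using assms by (auto simp: regular_approx_def intro!: continuous_intros)
  then obtain y where "y \<in> sphere_points n" "\<And>x. x \<in> sphere_points n \<Longrightarrow> norm (g y) \<le> norm (g x)"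
    using continuous_attains_inf [OF compact_sphere_points, of n "\<lambda>x. norm (g x)"]
      sphere_base_in_nsphere [of n] by (metis empty_iff)
  then show ?thesis
    using that [of "norm (g y)"] assms(2) by auto
qed

lemma regular_approx_eventually_nonzero:
  assumes "regular_approx n G g" "\<And>x. x \<in> sphere_points n \<Longrightarrow> g x \<noteq> 0"
  shows "\<forall>\<^sub>F r in sequentially. \<forall>x\<in>sphere_points n. G r x \<noteq> 0"
proof -
  obtain b where b: "b > 0" "\<And>x. x \<in> sphere_points n \<Longrightarrow> b \<le> norm (g x)"
    using regular_approx_bounded_below assms by blast
  have "\<forall>\<^sub>F r in sequentially. \<forall>x\<in>sphere_points n. dist (G r x) (g x) < b"
    using assms(1) b(1) by (auto simp: regular_approx_def dest: uniform_limitD)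
  then show ?thesis
    by (rule eventually_mono) (use b in \<open>force simp: dist_real_def\<close>)
qed

text \<open>A nonvanishing limit is bounded away from zero on the compact sphere, so the reciprocals
  are eventually regular and converge uniformly.\<close>

lemma regular_approx_divide [regular_approx_intros]:
  assumes F: "regular_approx n F f" and G: "regular_approx n G g"
    and nz: "\<And>x. x \<in> sphere_points n \<Longrightarrow> g x \<noteq> 0"
  shows "regular_approx n (\<lambda>r x. F r x / G r x) (\<lambda>x. f x / g x)"
proof -
  have "\<forall>\<^sub>F r in sequentially. regular_function n (G r) \<and> G r sphere_base = g sphere_base"
    using G by (simp add: regular_approx_def)
  then have "\<forall>\<^sub>F r in sequentially. regular_function n (\<lambda>x. inverse (G r x)) \<and>
      inverse (G r sphere_base) = inverse (g sphere_base)"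
    using regular_approx_eventually_nonzero [OF G nz]
    by (rule eventually_elim2) (simp_all add: regular_function_inverse)
  moreover obtain b where b: "b > 0" "\<And>x. x \<in> sphere_points n \<Longrightarrow> b \<le> norm (g x)"
    using regular_approx_bounded_below [OF G nz] by blast
  have "uniform_limit (sphere_points n) G g sequentially"
    using G by (simp add: regular_approx_def)
  from uniform_lim_inverse [OF this b(2,1)]
  have "uniform_limit (sphere_points n) (\<lambda>r x. inverse (G r x)) (\<lambda>x. inverse (g x)) sequentially"
    by (simp add: o_def)
  ultimately have "regular_approx n (\<lambda>r x. inverse (G r x)) (\<lambda>x. inverse (g x))"
    using G nz by (auto simp: regular_approx_def intro!: continuous_intros)
  from regular_approx_mult [OF F this] show ?thesis
    by (simp add: divide_inverse)
qed

lemma regular_approx_dot [regular_approx_intros]: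
  assumes "\<And>j. j \<le> k \<Longrightarrow> regular_approx n (\<lambda>r x. U r x j) (\<lambda>x. u x j)"
    and "\<And>j. j \<le> k \<Longrightarrow> regular_approx n (\<lambda>r x. V r x j) (\<lambda>x. v x j)"
  shows "regular_approx n (\<lambda>r x. dot k (U r x) (V r x)) (\<lambda>x. dot k (u x) (v x))"
  unfolding dot_def using assms by (intro regular_approx_intros) auto

text \<open>Polynomial approximants are shifted by constants that make them exact at the base point.
  The constants tend to \<open>0\<close>, so uniform convergence survives.\<close>

lemma continuous_imp_regular_approx:
  assumes g: "continuous_on (sphere_points n) g"
  obtains G where "regular_approx n G g"
proof -
  have "\<exists>P. polynomial_fun (Suc n) P \<and> (\<forall>x\<in>sphere_points n. \<bar>g x - P x\<bar> < inverse (real (Suc r)))" for r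
    using polynomial_fun_dense [OF g, of "inverse (real (Suc r))"] by (metis inverse_Suc)
  then obtain P where P: "\<And>r. polynomial_fun (Suc n) (P r)"
      "\<And>r x. x \<in> sphere_points n \<Longrightarrow> \<bar>g x - P r x\<bar> < inverse (real (Suc r))"
    by metis
  have lim: "uniform_limit (sphere_points n) P g sequentially"
  proof (rule uniform_limitI)
    fix e :: real assume "e > 0"
    then have "\<forall>\<^sub>F r in sequentially. inverse (real (Suc r)) < e"
      using LIMSEQ_inverse_real_of_nat order_tendstoD(2) by blast
    then show "\<forall>\<^sub>F r in sequentially. \<forall>x\<in>sphere_points n. dist (P r x) (g x) < e"
    proof eventually_elim
      case (elim r)
      show ?case
      proof
        fix x assume "x \<in> sphere_points n"
        then show "dist (P r x) (g x) < e"
          using P(2) [of x r] elim by (simp add: dist_real_def abs_minus_commute)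
      qed
    qed
  qed
  then have "(\<lambda>r. P r sphere_base) \<longlonglongrightarrow> g sphere_base"
    using sphere_base_in_nsphere by (rule tendsto_uniform_limitI)
  then have "(\<lambda>r. g sphere_base - P r sphere_base) \<longlonglongrightarrow> 0"
    by (auto intro: tendsto_eq_intros)
  then have "uniform_limit (sphere_points n) (\<lambda>r x. g sphere_base - P r sphere_base) (\<lambda>x. 0) sequentially"
    by (auto simp: uniform_limit_iff tendsto_iff elim: eventually_mono)
  from uniform_limit_add [OF lim this]
  have "regular_approx n (\<lambda>r x. P r x + (g sphere_base - P r sphere_base)) g"
    unfolding regular_approx_def using g P(1)
    by (auto intro!: always_eventually regular_function_polynomial polynomial_fun.intros)
  then show ?thesis
    by (rule that)
qed

section \<open>Sphere-valued maps with regular sphere-valued approximants\<close>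

definition regularly_approximable :: "nat \<Rightarrow> nat \<Rightarrow> ((nat \<Rightarrow> real) \<Rightarrow> (nat \<Rightarrow> real)) \<Rightarrow> bool"
  where "regularly_approximable n k u \<longleftrightarrow> u \<in> sphere_points n \<rightarrow> sphere_points k \<and>
    (\<exists>U. (\<forall>\<^sub>F r in sequentially. U r \<in> sphere_points n \<rightarrow> sphere_points k) \<and>
      (\<forall>j\<le>k. regular_approx n (\<lambda>r x. U r x j) (\<lambda>x. u x j)))"

lemma regularly_approximable_const:
  "c \<in> sphere_points k \<Longrightarrow> regularly_approximable n k (\<lambda>x. c)"
  unfolding regularly_approximable_def
  by (auto intro!: exI [of _ "\<lambda>r x. c"] regular_approx_intros)

text \<open>The axis is approximated coordinatewise and never normalized: a half turn about any
  nonzero vector preserves the sphere exactly.\<close>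

lemma regularly_approximable_half_turn:
  assumes v: "continuous_on (sphere_points n) v" "\<And>x i. x \<in> sphere_points n \<Longrightarrow> i > k \<Longrightarrow> v x i = 0"
      "\<And>x. x \<in> sphere_points n \<Longrightarrow> dot k (v x) (v x) \<noteq> 0"
    and u: "regularly_approximable n k u"
  shows "regularly_approximable n k (\<lambda>x. half_turn k (v x) (u x))"
proof -
  obtain U where U: "\<forall>\<^sub>F r in sequentially. U r \<in> sphere_points n \<rightarrow> sphere_points k"
    "\<And>j. j \<le> k \<Longrightarrow> regular_approx n (\<lambda>r x. U r x j) (\<lambda>x. u x j)"
    using u unfolding regularly_approximable_def by blast
  have "\<exists>G. regular_approx n G (\<lambda>x. v x j)" for j
    using continuous_imp_regular_approx continuous_on_product_then_coordinatewise [OF v(1)] by metis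
  then obtain W where W: "\<And>j. regular_approx n (W j) (\<lambda>x. v x j)"
    by metis
  \<comment> \<open>Coordinates beyond \<open>k\<close> are cut off so that the approximate half
    turns stay in \<open>S^k\<close>.\<close>
  define V where "V r x j = (if j \<le> k then W j r x else 0)" for r x j
  have V: "regular_approx n (\<lambda>r x. V r x j) (\<lambda>x. v x j)" if "j \<le> k" for j
    using W [of j] that by (simp add: V_def)
  have "\<forall>\<^sub>F r in sequentially. \<forall>x\<in>sphere_points n. dot k (V r x) (V r x) \<noteq> 0"
    by (rule regular_approx_eventually_nonzero [OF regular_approx_dot [OF V V]]) (use v(3) in simp_all)
  with U(1) have "\<forall>\<^sub>F r in sequentially.
      (\<lambda>x. half_turn k (V r x) (U r x)) \<in> sphere_points n \<rightarrow> sphere_points k"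
    by (rule eventually_elim2) (auto intro!: half_turn_in_sphere simp: V_def)
  moreover have "regular_approx n (\<lambda>r x. half_turn k (V r x) (U r x) j) (\<lambda>x. half_turn k (v x) (u x) j)"
    if "j \<le> k" for j
    unfolding half_turn_def using that U(2) V v(3) by (intro regular_approx_intros) auto
  moreover have "(\<lambda>x. half_turn k (v x) (u x)) \<in> sphere_points n \<rightarrow> sphere_points k"
    using u v by (auto simp: regularly_approximable_def intro!: half_turn_in_sphere)
  ultimately show ?thesis
    unfolding regularly_approximable_def by (intro conjI exI [of _ "\<lambda>r x. half_turn k (V r x) (U r x)"]) auto
qed

text \<open>Perturbing \<open>a\<close> and \<open>b\<close> separately still gives an exact
  rotation, because the formula divides by \<open>a^2 + b^2\<close>.\<close>

lemma regularly_approximable_complex_rotation: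
  assumes "odd k" and a: "continuous_on (sphere_points n) a" and b: "continuous_on (sphere_points n) b"
    and ab: "\<And>x. x \<in> sphere_points n \<Longrightarrow> (a x)\<^sup>2 + (b x)\<^sup>2 \<noteq> 0"
    and u: "regularly_approximable n k u"
  shows "regularly_approximable n k (\<lambda>x. complex_rotation (a x) (b x) (u x))"
proof -
  obtain U where U: "\<forall>\<^sub>F r in sequentially. U r \<in> sphere_points n \<rightarrow> sphere_points k"
    "\<And>j. j \<le> k \<Longrightarrow> regular_approx n (\<lambda>r x. U r x j) (\<lambda>x. u x j)"
    using u unfolding regularly_approximable_def by blast
  obtain A B where A: "regular_approx n A a" and B: "regular_approx n B b"
    using continuous_imp_regular_approx a b by metis
  have "\<forall>\<^sub>F r in sequentially. \<forall>x\<in>sphere_points n. (A r x)\<^sup>2 + (B r x)\<^sup>2 \<noteq> 0"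
    by (rule regular_approx_eventually_nonzero [OF regular_approx_add
          [OF regular_approx_power [OF A] regular_approx_power [OF B]] ab])
  with U(1) have "\<forall>\<^sub>F r in sequentially.
      (\<lambda>x. complex_rotation (A r x) (B r x) (U r x)) \<in> sphere_points n \<rightarrow> sphere_points k"
    by (rule eventually_elim2) (auto intro!: complex_rotation_in_sphere \<open>odd k\<close>)
  moreover have "regular_approx n (\<lambda>r x. complex_rotation (A r x) (B r x) (U r x) j)
      (\<lambda>x. complex_rotation (a x) (b x) (u x) j)" if "j \<le> k" for j
  proof (cases "even j")
    case True
    \<comment> \<open>For even \<open>j\<close> the formula reads coordinate \<open>j + 1\<close>,
      which is in range since \<open>k\<close> is odd.\<close>
    then have "Suc j \<le> k"
      using that \<open>odd k\<close> by (metis le_neq_implies_less Suc_leI)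
    then show ?thesis
      unfolding complex_rotation_def using that True U(2) A B ab
      by simp (intro regular_approx_intros; auto)
  next
    case False
    then show ?thesis
      unfolding complex_rotation_def using that U(2) A B ab
      by simp (intro regular_approx_intros; auto)
  qed
  moreover have "(\<lambda>x. complex_rotation (a x) (b x) (u x)) \<in> sphere_points n \<rightarrow> sphere_points k"
    using u ab by (auto simp: regularly_approximable_def intro!: complex_rotation_in_sphere \<open>odd k\<close>)
  ultimately show ?thesis
    unfolding regularly_approximable_def
    by (intro conjI exI [of _ "\<lambda>r x. complex_rotation (A r x) (B r x) (U r x)"]) auto
qed

lemma regularly_approximable_difference:
  assumes z: "regularly_approximable n k z" and p: "regularly_approximable n k p"
    and zp: "\<And>x. x \<in> sphere_points n \<Longrightarrow> \<not> (z x 0 = -1 \<and> p x 0 = 1)"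
  shows "regularly_approximable n k (\<lambda>x. difference k (z x) (p x))"
proof -
  obtain Z P where Z: "\<forall>\<^sub>F r in sequentially. Z r \<in> sphere_points n \<rightarrow> sphere_points k"
    "\<And>j. j \<le> k \<Longrightarrow> regular_approx n (\<lambda>r x. Z r x j) (\<lambda>x. z x j)"
    and P: "\<forall>\<^sub>F r in sequentially. P r \<in> sphere_points n \<rightarrow> sphere_points k"
    "\<And>j. j \<le> k \<Longrightarrow> regular_approx n (\<lambda>r x. P r x j) (\<lambda>x. p x j)"
    using z p unfolding regularly_approximable_def by blast
  have d: "1 + z x 0 + ((1 - p x 0) / 2)\<^sup>2 * (1 - z x 0) \<noteq> 0" if "x \<in> sphere_points n" for x
    using difference_denominator_pos [of "z x" k "p x"] that z p zp
    by (force simp: regularly_approximable_def)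
  \<comment> \<open>A nonzero denominator also rules out the forbidden pair for the approximants, so
    their images lie in the sphere.\<close>
  have "\<forall>\<^sub>F r in sequentially. \<forall>x\<in>sphere_points n.
      1 + Z r x 0 + ((1 - P r x 0) / 2)\<^sup>2 * (1 - Z r x 0) \<noteq> 0"
  proof (rule regular_approx_eventually_nonzero [OF _ d])
    show "regular_approx n (\<lambda>r x. 1 + Z r x 0 + ((1 - P r x 0) / 2)\<^sup>2 * (1 - Z r x 0))
        (\<lambda>x. 1 + z x 0 + ((1 - p x 0) / 2)\<^sup>2 * (1 - z x 0))"
      using Z(2) P(2) by (intro regular_approx_intros) auto
  qed
  with Z(1) P(1) have "\<forall>\<^sub>F r in sequentially.
      (\<lambda>x. difference k (Z r x) (P r x)) \<in> sphere_points n \<rightarrow> sphere_points k"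
  proof eventually_elim
    case (elim r)
    then show ?case
      by (auto intro!: difference_in_sphere)
  qed
  moreover have "regular_approx n (\<lambda>r x. difference k (Z r x) (P r x) j)
      (\<lambda>x. difference k (z x) (p x) j)" if "j \<le> k" for j
    unfolding difference_def using that Z(2) P(2) d by (intro regular_approx_intros) auto
  moreover have "(\<lambda>x. difference k (z x) (p x)) \<in> sphere_points n \<rightarrow> sphere_points k"
    using z p zp by (auto simp: regularly_approximable_def intro!: difference_in_sphere)
  ultimately show ?thesis
    unfolding regularly_approximable_def
    by (intro conjI exI [of _ "\<lambda>r x. difference k (Z r x) (P r x)"]) auto
qed

lemma continuous_on_vector_add:
  fixes u v :: "'a::topological_space \<Rightarrow> nat \<Rightarrow> real"
  assumes "continuous_on S u" "continuous_on S v"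
  shows "continuous_on S (\<lambda>x i. u x i + v x i)"
  by (intro continuous_on_coordinatewise_then_product continuous_on_add
      continuous_on_product_then_coordinatewise [OF assms(1)]
      continuous_on_product_then_coordinatewise [OF assms(2)])

lemma broken_path_half_turn_vectors:
  assumes "broken_path k (Suc m) g"
  shows "dot k (g m) (g m) \<noteq> 0" "i > k \<Longrightarrow> g m i = 0" "i > k \<Longrightarrow> g (Suc m) i + g m i = 0"
  using broken_path_Suc [OF assms] by (auto simp: sphere_points_iff)

lemma regularly_approximable_half_turns:
  assumes g: "\<And>j. j \<le> Suc m \<Longrightarrow> continuous_on (sphere_points n) (\<lambda>x. g x j)"
    and path: "\<And>x. x \<in> sphere_points n \<Longrightarrow> broken_path k (Suc m) (g x)"
    and u: "regularly_approximable n k u"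
  shows "regularly_approximable n k (\<lambda>x. half_turn k (g x m) (u x))"
    and "regularly_approximable n k (\<lambda>x. half_turn k (\<lambda>i. g x (Suc m) i + g x m i) (u x))"
proof -
  have gm: "continuous_on (sphere_points n) (\<lambda>x. g x m)"
    and gSm: "continuous_on (sphere_points n) (\<lambda>x. g x (Suc m))"
    by (simp_all add: g)
  show "regularly_approximable n k (\<lambda>x. half_turn k (g x m) (u x))"
    by (rule regularly_approximable_half_turn [OF gm])
      (use broken_path_half_turn_vectors(1,2) [OF path] u in auto)
  show "regularly_approximable n k (\<lambda>x. half_turn k (\<lambda>i. g x (Suc m) i + g x m i) (u x))"
    by (rule regularly_approximable_half_turn [OF continuous_on_vector_add [OF gSm gm]])
      (use broken_path_half_turn_vectors(3) [OF path] broken_path_Suc(6) [OF path] u in auto)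
qed

lemma regularly_approximable_transport:
  assumes "\<And>j. j \<le> m \<Longrightarrow> continuous_on (sphere_points n) (\<lambda>x. g x j)"
    and "\<And>x. x \<in> sphere_points n \<Longrightarrow> broken_path k m (g x)" and "regularly_approximable n k u"
  shows "regularly_approximable n k (\<lambda>x. transport k (g x) m (u x))"
  using assms
proof (induction m)
  case (Suc m)
  have "regularly_approximable n k (\<lambda>x. transport k (g x) m (u x))"
    using Suc.prems broken_path_Suc(1) by (intro Suc.IH) auto
  then show ?case
    unfolding transport.simps
    by (intro regularly_approximable_half_turns [OF Suc.prems(1,2)])
qed simp

lemma regularly_approximable_transport_back:
  assumes "\<And>j. j \<le> m \<Longrightarrow> continuous_on (sphere_points n) (\<lambda>x. g x j)"
    and "\<And>x. x \<in> sphere_points n \<Longrightarrow> broken_path k m (g x)" and "regularly_approximable n k u"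
  shows "regularly_approximable n k (\<lambda>x. transport_back k (g x) m (u x))"
  using assms
proof (induction m arbitrary: u)
  case (Suc m)
  have "regularly_approximable n k
      (\<lambda>x. half_turn k (g x m) (half_turn k (\<lambda>i. g x (Suc m) i + g x m i) (u x)))"
    by (intro regularly_approximable_half_turns [OF Suc.prems(1,2)] Suc.prems(3))
  then show ?case
    unfolding transport_back.simps
    using Suc.prems(1,2) broken_path_Suc(1) by (intro Suc.IH) auto
qed simp

subsection \<open>Homotopies of pointed maps\<close>

lemma pointed_homotopyI:
  fixes H :: "real \<Rightarrow> (nat \<Rightarrow> real) \<Rightarrow> (nat \<Rightarrow> real)"
  assumes cont: "continuous_on ({0..1} \<times> sphere_points n) (\<lambda>z. H (fst z) (snd z))"
    and sphere: "\<And>s x. s \<in> {0..1} \<Longrightarrow> x \<in> sphere_points n \<Longrightarrow> H s x \<in> sphere_points k"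
    and base: "\<And>s. s \<in> {0..1} \<Longrightarrow> H s sphere_base = sphere_base"
    and f: "\<And>x. x \<in> sphere_points n \<Longrightarrow> H 0 x = f x"
    and g: "\<And>x. x \<in> sphere_points n \<Longrightarrow> H 1 x = g x"
  shows "(f, g) \<in> pointed_homotopy n k"
proof -
  have "prod_topology (top_of_set {0..1::real}) (nsphere n) = top_of_set ({0..1} \<times> sphere_points n)"
    by (subst nsphere_eq_top_of_set) simp
  then have "continuous_map (prod_topology (top_of_set {0..1::real}) (nsphere n)) (nsphere k)
      (\<lambda>z. H (fst z) (snd z))"
    using cont sphere by (subst (2) nsphere_eq_top_of_set) auto
  then have "homotopic_with (\<lambda>h. h sphere_base = sphere_base) (nsphere n) (nsphere k) (H 0) (H 1)"
    using base unfolding homotopic_with_def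
    by (intro exI [of _ "\<lambda>z. H (fst z) (snd z)"]) auto
  then have "homotopic_with (\<lambda>h. h sphere_base = sphere_base) (nsphere n) (nsphere k) f g"
    by (rule homotopic_with_eq) (use f g sphere_base_in_nsphere in auto)
  then show ?thesis
    by (simp add: pointed_homotopy_def)
qed

lemma pointed_homotopy_trans:
  "(f, g) \<in> pointed_homotopy n k \<Longrightarrow> (g, h) \<in> pointed_homotopy n k \<Longrightarrow> (f, h) \<in> pointed_homotopy n k"
  using equiv_pointed_homotopy by (metis equivE transE)

lemma pointed_homotopy_sym: "(f, g) \<in> pointed_homotopy n k \<Longrightarrow> (g, f) \<in> pointed_homotopy n k"
  using equiv_pointed_homotopy by (metis equivE symE)

section \<open>Great arcs as normalized segments, and maps that are nowhere antipodal\<close>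

definition great_arc ::
    "nat \<Rightarrow> real \<Rightarrow> (nat \<Rightarrow> real) \<Rightarrow> (nat \<Rightarrow> real) \<Rightarrow> (nat \<Rightarrow> real)"
  where "great_arc k s u v = (\<lambda>i. ((1 - s) * u i + s * v i)
    / sqrt ((1 - s)\<^sup>2 + 2 * s * (1 - s) * dot k u v + s\<^sup>2))"

lemma great_arc_denominator_pos:
  assumes "u \<in> sphere_points k" "v \<in> sphere_points k" "dot k u v \<noteq> -1" "s \<in> {0..1}"
  shows "(1 - s)\<^sup>2 + 2 * s * (1 - s) * dot k u v + s\<^sup>2 > 0"
proof (cases "s = 0 \<or> s = 1")
  case False
  then have "s * (1 - s) > 0" "dot k u v > -1"
    using assms sphere_dot_ge [OF assms(1,2)] by auto
  then have "s * (1 - s) * (dot k u v + 1) > 0"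
    by simp
  \<comment> \<open>The squared length of the segment point becomes a square plus a multiple of
    \<open>dot k u v + 1\<close>, which is positive away from antipodes.\<close>
  moreover have "(1 - s)\<^sup>2 + 2 * s * (1 - s) * dot k u v + s\<^sup>2
      = (1 - 2 * s)\<^sup>2 + 2 * (s * (1 - s) * (dot k u v + 1))"
    by (simp add: power2_eq_square algebra_simps)
  moreover have "(1 - 2 * s)\<^sup>2 \<ge> 0"
    by simp
  ultimately show ?thesis
    by linarith
qed auto

lemma great_arc_in_sphere:
  assumes "u \<in> sphere_points k" "v \<in> sphere_points k" "dot k u v \<noteq> -1" "s \<in> {0..1}"
  shows "great_arc k s u v \<in> sphere_points k"
proof -
  define d where "d = (1 - s)\<^sup>2 + 2 * s * (1 - s) * dot k u v + s\<^sup>2"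
  have d: "d > 0"
    using great_arc_denominator_pos [OF assms] by (simp add: d_def)
  have "dot k (\<lambda>i. (1 - s) * u i + s * v i) (\<lambda>i. (1 - s) * u i + s * v i) = d"
    using assms by (simp add: dot_simps sphere_points_iff dot_commute [of k v u] d_def
        power2_eq_square)
  moreover have "dot k (great_arc k s u v) (great_arc k s u v) =
      dot k (\<lambda>i. (1 - s) * u i + s * v i) (\<lambda>i. (1 - s) * u i + s * v i) / d"
    unfolding great_arc_def d_def [symmetric] using d
    by (simp add: dot_simps(7,8))
  ultimately show ?thesis
    using assms d by (simp add: sphere_points_iff) (simp add: great_arc_def)
qed

lemma great_arc_ends [simp]: "great_arc k 0 u v = u" "great_arc k 1 u v = v"
  by (simp_all add: great_arc_def)

lemma great_arc_same: "u \<in> sphere_points k \<Longrightarrow> great_arc k s u u = u"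
proof -
  assume "u \<in> sphere_points k"
  then have "(1 - s)\<^sup>2 + 2 * s * (1 - s) * dot k u u + s\<^sup>2 = 1"
    by (simp add: sphere_points_iff power2_eq_square algebra_simps)
  then show ?thesis
    by (simp add: great_arc_def algebra_simps)
qed

lemma continuous_on_great_arc:
  assumes s: "continuous_on S s" and u: "continuous_on S u" and v: "continuous_on S v"
    and "\<And>x. x \<in> S \<Longrightarrow> s x \<in> {0..1}" "\<And>x. x \<in> S \<Longrightarrow> u x \<in> sphere_points k"
      "\<And>x. x \<in> S \<Longrightarrow> v x \<in> sphere_points k" "\<And>x. x \<in> S \<Longrightarrow> dot k (u x) (v x) \<noteq> -1"
  shows "continuous_on S (\<lambda>x. great_arc k (s x) (u x) (v x))"
proof (rule continuous_on_coordinatewise_then_product)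
  fix i
  have "(1 - s x)\<^sup>2 + 2 * s x * (1 - s x) * dot k (u x) (v x) + (s x)\<^sup>2 \<noteq> 0" if "x \<in> S" for x
    using great_arc_denominator_pos [of "u x" k "v x" "s x"] assms(4-7) [OF that] by auto
  then show "continuous_on S (\<lambda>x. great_arc k (s x) (u x) (v x) i)"
    unfolding great_arc_def
    by (intro continuous_intros s u v continuous_on_product_then_coordinatewise [OF u]
        continuous_on_product_then_coordinatewise [OF v]) auto
qed

lemma nonantipodal_imp_homotopic:
  assumes u: "continuous_on (sphere_points n) u" "u \<in> sphere_points n \<rightarrow> sphere_points k"
    and v: "continuous_on (sphere_points n) v" "v \<in> sphere_points n \<rightarrow> sphere_points k"
    and uv: "\<And>x. x \<in> sphere_points n \<Longrightarrow> dot k (u x) (v x) \<noteq> -1"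
    and base: "u sphere_base = sphere_base" "v sphere_base = sphere_base"
  shows "(u, v) \<in> pointed_homotopy n k"
proof (rule pointed_homotopyI [where H = "\<lambda>s x. great_arc k s (u x) (v x)"])
  show "continuous_on ({0..1} \<times> sphere_points n)
      (\<lambda>z. great_arc k (fst z) (u (snd z)) (v (snd z)))"
  proof (rule continuous_on_great_arc)
    show "continuous_on ({0..1} \<times> sphere_points n) (\<lambda>z. u (snd z))"
      by (rule continuous_on_compose2 [OF u(1)]) (auto intro: continuous_on_snd)
    show "continuous_on ({0..1} \<times> sphere_points n) (\<lambda>z. v (snd z))"
      by (rule continuous_on_compose2 [OF v(1)]) (auto intro: continuous_on_snd)
  qed (use u v uv in \<open>auto intro: continuous_on_fst\<close>)
  show "great_arc k s (u x) (v x) \<in> sphere_points k"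
    if "s \<in> {0..1}" "x \<in> sphere_points n" for s x
    using that u v uv by (intro great_arc_in_sphere) auto
qed (use base great_arc_same [OF sphere_base_in_nsphere] in auto)

lemma regular_function_continuous:
  assumes "regular_function n g"
  shows "continuous_on (sphere_points n) g"
proof -
  obtain P Q where PQ: "polynomial_fun (Suc n) P" "polynomial_fun (Suc n) Q"
    "\<And>x. x \<in> sphere_points n \<Longrightarrow> Q x \<noteq> 0 \<and> g x = P x / Q x"
    using assms unfolding regular_function_def by metis
  have "continuous_on (sphere_points n) (\<lambda>x. P x / Q x)"
    using PQ by (intro continuous_intros continuous_on_polynomial_fun) auto
  then show ?thesis
    by (rule continuous_on_eq) (use PQ in auto)
qed

lemma continuous_on_into_sphere:
  assumes "\<And>j. j \<le> k \<Longrightarrow> continuous_on S (\<lambda>x. u x j)" "u \<in> S \<rightarrow> sphere_points k"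
  shows "continuous_on S u"
proof (rule continuous_on_coordinatewise_then_product)
  fix j
  show "continuous_on S (\<lambda>x. u x j)"
  proof (cases "j \<le> k")
    case False
    then have "u x j = 0" if "x \<in> S" for x
      using assms(2) that by (auto simp: sphere_points_iff Pi_iff)
    then show ?thesis
      using continuous_on_cong [of S S "\<lambda>x. u x j" "\<lambda>x. 0"] by simp
  qed (use assms in auto)
qed

text \<open>A close approximant is nowhere antipodal to \<open>u\<close>, hence joined to it by
  great arcs; exactness at the base point keeps this homotopy pointed.\<close>

lemma regularly_approximable_imp_homotopic:
  assumes u: "regularly_approximable n k u" and base: "u sphere_base = sphere_base"
  obtains g where "regular_map (Suc n) (sphere_points n) (Suc k) (sphere_points k) g"
    "(u, g) \<in> pointed_homotopy n k"
proof -
  obtain U where U: "\<forall>\<^sub>F r in sequentially. U r \<in> sphere_points n \<rightarrow> sphere_points k"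
      "\<And>j. j \<le> k \<Longrightarrow> regular_approx n (\<lambda>r x. U r x j) (\<lambda>x. u x j)"
    and u_sphere: "u \<in> sphere_points n \<rightarrow> sphere_points k"
    using u unfolding regularly_approximable_def by blast
  have regular: "\<forall>\<^sub>F r in sequentially. \<forall>j\<in>{..k}. regular_function n (\<lambda>x. U r x j) \<and>
      U r sphere_base j = u sphere_base j"
    using U(2) by (intro eventually_ball_finite) (auto simp: regular_approx_def)
  \<comment> \<open>Coordinate errors below \<open>1 / (k + 1)\<close> bound the squared distance by
    \<open>1\<close>, whereas antipodal unit vectors have squared distance \<open>4\<close>.\<close>
  have close: "\<forall>\<^sub>F r in sequentially. \<forall>j\<in>{..k}. \<forall>x\<in>sphere_points n. dist (U r x j) (u x j) < 1 / real (Suc k)"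
    using U(2) by (intro eventually_ball_finite ballI uniform_limitD) (auto simp: regular_approx_def)
  obtain r where r: "U r \<in> sphere_points n \<rightarrow> sphere_points k"
      "\<And>j. j \<le> k \<Longrightarrow> regular_function n (\<lambda>x. U r x j)"
      "\<And>j. j \<le> k \<Longrightarrow> U r sphere_base j = u sphere_base j"
      "\<And>j x. j \<le> k \<Longrightarrow> x \<in> sphere_points n \<Longrightarrow> \<bar>U r x j - u x j\<bar> < 1 / real (Suc k)"
    using eventually_happens' [OF _ eventually_conj [OF U(1) eventually_conj [OF regular close]]]
    by (auto simp: dist_real_def)
  have "dot k (u x) (U r x) \<noteq> -1" if x: "x \<in> sphere_points n" for x
  proof
    assume *: "dot k (u x) (U r x) = -1"
    have "u x \<in> sphere_points k" "U r x \<in> sphere_points k"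
      using x u_sphere r(1) by auto
    then have "dot k (\<lambda>i. U r x i - u x i) (\<lambda>i. U r x i - u x i) = 4"
      using * by (simp add: dot_simps sphere_points_iff dot_commute [of k "U r x" "u x"])
    moreover have "dot k (\<lambda>i. U r x i - u x i) (\<lambda>i. U r x i - u x i) \<le> (\<Sum>i\<le>k. 1 / real (Suc k))"
      unfolding dot_def
    proof (rule sum_mono)
      fix j assume "j \<in> {..k}"
      then have "\<bar>U r x j - u x j\<bar> \<le> 1 / real (Suc k)"
        using r(4) [of j x] x by simp
      moreover from this have "\<bar>U r x j - u x j\<bar> \<le> 1"
        by (rule order_trans) simp
      ultimately have "\<bar>U r x j - u x j\<bar> * \<bar>U r x j - u x j\<bar> \<le> 1 / real (Suc k) * 1"
        by (intro mult_mono) auto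
      then show "(U r x j - u x j) * (U r x j - u x j) \<le> 1 / real (Suc k)"
        by (simp flip: abs_mult)
    qed
    ultimately show False
      by simp
  qed
  moreover have "U r sphere_base = sphere_base"
  proof
    fix j
    show "U r sphere_base j = sphere_base j"
    proof (cases "j \<le> k")
      case True
      then show ?thesis
        using r(3) base by simp
    next
      case False
      then show ?thesis
        using r(1) sphere_base_in_nsphere [of n] by (auto simp: sphere_points_iff Pi_iff)
    qed
  qed
  moreover have "continuous_on (sphere_points n) (U r)"
    using r(1,2) by (intro continuous_on_into_sphere) (auto intro: regular_function_continuous)
  moreover have "continuous_on (sphere_points n) u"
    using U(2) u_sphere by (intro continuous_on_into_sphere) (auto simp: regular_approx_def)
  ultimately have "(u, U r) \<in> pointed_homotopy n k"
    using u_sphere r(1) base by (intro nonantipodal_imp_homotopic)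
  moreover have "regular_map (Suc n) (sphere_points n) (Suc k) (sphere_points k) (U r)"
    using r(1,2) unfolding regular_map_def regular_function_def less_Suc_eq_le by blast
  ultimately show ?thesis
    using that by blast
qed

section \<open>Continuity of the constructions on the sphere\<close>

lemma continuous_on_half_turn:
  assumes v: "continuous_on S v" and u: "continuous_on S u" and "\<And>x. x \<in> S \<Longrightarrow> dot k (v x) (v x) \<noteq> 0"
  shows "continuous_on S (\<lambda>x. half_turn k (v x) (u x))"
  unfolding half_turn_def
  by (intro continuous_on_coordinatewise_then_product continuous_intros u v assms(3) ballI
      continuous_on_product_then_coordinatewise [OF u]
      continuous_on_product_then_coordinatewise [OF v])

lemma continuous_on_difference:
  assumes z: "continuous_on S z" and p: "continuous_on S p"
    and "\<And>x. x \<in> S \<Longrightarrow> z x \<in> sphere_points k" "\<And>x. x \<in> S \<Longrightarrow> p x \<in> sphere_points k"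
      "\<And>x. x \<in> S \<Longrightarrow> \<not> (z x 0 = -1 \<and> p x 0 = 1)"
  shows "continuous_on S (\<lambda>x. difference k (z x) (p x))"
proof -
  have "1 + z x 0 + ((1 - p x 0) / 2)\<^sup>2 * (1 - z x 0) \<noteq> 0" if "x \<in> S" for x
    using difference_denominator_pos [of "z x" k "p x"] assms(3-5) [OF that] by auto
  then show ?thesis
    unfolding difference_def
    by (intro continuous_on_coordinatewise_then_product continuous_intros z p ballI
        continuous_on_product_then_coordinatewise [OF z]
        continuous_on_product_then_coordinatewise [OF p]) auto
qed

lemma continuous_on_transport_back:
  assumes "\<And>j. j \<le> m \<Longrightarrow> continuous_on S (\<lambda>x. g x j)"
    and "\<And>x. x \<in> S \<Longrightarrow> broken_path k m (g x)" and "continuous_on S u"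
  shows "continuous_on S (\<lambda>x. transport_back k (g x) m (u x))"
  using assms
proof (induction m arbitrary: u)
  case (Suc m)
  have gm: "continuous_on S (\<lambda>x. g x m)" and gSm: "continuous_on S (\<lambda>x. g x (Suc m))"
    by (simp_all add: Suc.prems(1))
  have "continuous_on S (\<lambda>x. half_turn k (\<lambda>i. g x (Suc m) i + g x m i) (u x))"
    using broken_path_Suc(6) [OF Suc.prems(2)]
    by (intro continuous_on_half_turn [OF continuous_on_vector_add [OF gSm gm]] Suc.prems(3))
  then have "continuous_on S
      (\<lambda>x. half_turn k (g x m) (half_turn k (\<lambda>i. g x (Suc m) i + g x m i) (u x)))"
    using broken_path_half_turn_vectors(1) [OF Suc.prems(2)]
    by (intro continuous_on_half_turn [OF gm])
  then show ?case
    unfolding transport_back.simps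
    using Suc.prems(1,2) broken_path_Suc(1) by (intro Suc.IH) auto
qed simp

subsection \<open>Twice a homotopy class\<close>

text \<open>The pieces glue because both are the base point on the equator, which contains
  \<open>sphere_base\<close> since \<open>n > 0\<close>.\<close>

lemma pointed_homotopy_hemispheresI:
  fixes A B :: "real \<Rightarrow> (nat \<Rightarrow> real) \<Rightarrow> (nat \<Rightarrow> real)"
  assumes n: "n > 0"
    and contA: "continuous_on ({0..1} \<times> {x \<in> sphere_points n. x n \<le> 0}) (\<lambda>z. A (fst z) (snd z))"
    and contB: "continuous_on ({0..1} \<times> {x \<in> sphere_points n. 0 \<le> x n}) (\<lambda>z. B (fst z) (snd z))"
    and A: "\<And>s x. s \<in> {0..1} \<Longrightarrow> x \<in> sphere_points n \<Longrightarrow> x n \<le> 0 \<Longrightarrow> A s x \<in> sphere_points k"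
    and B: "\<And>s x. s \<in> {0..1} \<Longrightarrow> x \<in> sphere_points n \<Longrightarrow> 0 \<le> x n \<Longrightarrow> B s x \<in> sphere_points k"
    and equator: "\<And>s x. s \<in> {0..1} \<Longrightarrow> x \<in> sphere_points n \<Longrightarrow> x n = 0 \<Longrightarrow> A s x = sphere_base \<and> B s x = sphere_base"
    and f: "\<And>x. x \<in> sphere_points n \<Longrightarrow> x n \<le> 0 \<Longrightarrow> f x = A 0 x"
      "\<And>x. x \<in> sphere_points n \<Longrightarrow> 0 \<le> x n \<Longrightarrow> f x = B 0 x"
    and g: "\<And>x. x \<in> sphere_points n \<Longrightarrow> x n \<le> 0 \<Longrightarrow> g x = A 1 x"
      "\<And>x. x \<in> sphere_points n \<Longrightarrow> 0 \<le> x n \<Longrightarrow> g x = B 1 x"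
  shows "(f, g) \<in> pointed_homotopy n k"
proof (rule pointed_homotopyI [where H = "\<lambda>s x. if x n \<le> 0 then A s x else B s x"])
  let ?S = "{0..1::real} \<times> sphere_points n"
  have lower: "{z \<in> ?S. snd z n \<le> 0} = {0..1} \<times> {x \<in> sphere_points n. x n \<le> 0}"
    and upper: "{z \<in> ?S. 0 \<le> snd z n} = {0..1} \<times> {x \<in> sphere_points n. 0 \<le> x n}"
    by auto
  show "continuous_on ?S (\<lambda>z. if snd z n \<le> 0 then A (fst z) (snd z) else B (fst z) (snd z))"
  proof (rule continuous_on_cases_le)
    show "continuous_on {z \<in> ?S. snd z n \<le> 0} (\<lambda>z. A (fst z) (snd z))"
      unfolding lower by (rule contA)
    show "continuous_on {z \<in> ?S. 0 \<le> snd z n} (\<lambda>z. B (fst z) (snd z))"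
      unfolding upper by (rule contB)
    show "continuous_on ?S (\<lambda>z. snd z n)"
      by (rule continuous_on_product_then_coordinatewise [OF continuous_on_snd [OF continuous_on_id]])
    show "A (fst z) (snd z) = B (fst z) (snd z)" if "z \<in> ?S" "snd z n = 0" for z
      using equator [of "fst z" "snd z"] that by auto
  qed
  show "(if sphere_base n \<le> 0 then A s sphere_base else B s sphere_base) = sphere_base"
    if "s \<in> {0..1}" for s
    using equator [OF that sphere_base_in_nsphere] n by simp
qed (use A B f g in auto)

lemma continuous_on_fun_upd:
  fixes d :: "'a::topological_space \<Rightarrow> nat \<Rightarrow> real"
  assumes "continuous_on S d" "continuous_on S c"
  shows "continuous_on S (\<lambda>x. (d x)(i := c x))"
proof (rule continuous_on_coordinatewise_then_product)
  fix j
  show "continuous_on S (\<lambda>x. ((d x)(i := c x)) j)"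
    using assms(2) continuous_on_product_then_coordinatewise [OF assms(1)]
    by (cases "j = i") simp_all
qed

section \<open>The upper hemisphere as a disc\<close>

definition height :: "nat \<Rightarrow> (nat \<Rightarrow> real) \<Rightarrow> real"
  where "height n d = sqrt (max 0 (1 - (\<Sum>i<n. (d i)\<^sup>2)))"

definition disc_lift :: "nat \<Rightarrow> (nat \<Rightarrow> real) \<Rightarrow> (nat \<Rightarrow> real)"
  where "disc_lift n d = (\<lambda>i. if i < n then d i else if i = n then height n d else 0)"

text \<open>The upper hemisphere is parametrized by the unit disc of \<open>R^n\<close>; outside the disc the height is
  \<open>0\<close>, so that the pinch map takes the base point as its value.\<close>

definition disc_map :: "nat \<Rightarrow> ((nat \<Rightarrow> real) \<Rightarrow> (nat \<Rightarrow> real)) \<Rightarrow> (nat \<Rightarrow> real) \<Rightarrow> (nat \<Rightarrow> real)"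
  where "disc_map n f d = f (sphere_pinch n (disc_lift n d))"

lemma sum_squares_atMost: "(\<Sum>i\<le>n. (x i)\<^sup>2) = (\<Sum>i<n. (x i)\<^sup>2) + (x n)\<^sup>2" for x :: "nat \<Rightarrow> real"
  by (simp add: lessThan_Suc_atMost [symmetric])

lemma sphere_disc: "x \<in> sphere_points n \<Longrightarrow> (\<Sum>i<n. (x i)\<^sup>2) = 1 - (x n)\<^sup>2"
  by (simp add: nsphere sum_squares_atMost)

lemma pinch_disc_lift_in_sphere:
  assumes "n > 0"
  shows "sphere_pinch n (disc_lift n d) \<in> sphere_points n"
proof (cases "(\<Sum>i<n. (d i)\<^sup>2) \<le> 1")
  case True
  then have "disc_lift n d \<in> sphere_points n"
    by (simp add: nsphere sum_squares_atMost) (simp add: disc_lift_def height_def)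
  then show ?thesis
    by (rule sphere_pinch_in_nsphere [OF assms])
next
  case False
  then have "disc_lift n d n = 0"
    by (simp add: disc_lift_def height_def)
  then show ?thesis
    using sphere_pinch_base sphere_base_in_nsphere by metis
qed

lemma continuous_on_pinch_disc_lift: "continuous_on S (\<lambda>d. sphere_pinch n (disc_lift n d))"
proof (rule continuous_on_coordinatewise_then_product)
  fix i
  have height: "continuous_on S (height n)"
    unfolding height_def by (intro continuous_intros)
  consider "i = 0" | "0 < i" "i < n" | "i \<noteq> 0" "i = n" | "i \<noteq> 0" "i > n"
    by linarith
  then show "continuous_on S (\<lambda>d. sphere_pinch n (disc_lift n d) i)"
  proof cases
    case 3
    then have "sphere_pinch n (disc_lift n d) i = 2 * height n d * d 0" for d
      by (simp add: sphere_pinch_def disc_lift_def)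
    then show ?thesis
      by (simp, intro continuous_intros height)
  qed (simp_all add: sphere_pinch_def disc_lift_def, (intro continuous_intros height)+)
qed

section \<open>A pointed map viewed as a map of the disc modulo its boundary\<close>

locale sphere_map =
  fixes n k :: nat and f :: "(nat \<Rightarrow> real) \<Rightarrow> (nat \<Rightarrow> real)"
  assumes n: "n > 0"
    and f_continuous: "continuous_on (sphere_points n) f"
    and f_sphere: "f \<in> sphere_points n \<rightarrow> sphere_points k"
    and f_base: "f sphere_base = sphere_base"
begin

abbreviation h :: "(nat \<Rightarrow> real) \<Rightarrow> (nat \<Rightarrow> real)"
  where "h \<equiv> disc_map n f"

lemma h_sphere: "h d \<in> sphere_points k"
  using f_sphere pinch_disc_lift_in_sphere [OF n] by (auto simp: disc_map_def)

lemma h_dot [simp]: "dot k (h d) (h d) = 1"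
  using h_sphere by (simp add: sphere_points_iff)

lemma continuous_on_h: "continuous_on S d \<Longrightarrow> continuous_on S (\<lambda>x. h (d x))"
proof -
  have "continuous_on UNIV h"
    unfolding disc_map_def
    by (rule continuous_on_compose2 [OF f_continuous continuous_on_pinch_disc_lift])
      (use pinch_disc_lift_in_sphere [OF n] in auto)
  then show "continuous_on S d \<Longrightarrow> continuous_on S (\<lambda>x. h (d x))"
    by (rule continuous_on_compose2) auto
qed

lemma h_outside: "1 \<le> (\<Sum>i<n. (d i)\<^sup>2) \<Longrightarrow> h d = sphere_base"
  using sphere_pinch_base [of "disc_lift n d" n] f_base
  by (simp add: disc_map_def disc_lift_def height_def)

lemma h_equator: "x \<in> sphere_points n \<Longrightarrow> x n = 0 \<Longrightarrow> h x = sphere_base"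
  by (rule h_outside) (simp add: sphere_disc)

lemma h_upper:
  assumes "x \<in> sphere_points n" "0 \<le> x n"
  shows "h x = f (sphere_pinch n x)"
proof -
  have "disc_lift n x = x"
    using assms by (auto simp: disc_lift_def height_def sphere_disc fun_eq_iff sphere_points_iff)
  then show ?thesis
    by (simp add: disc_map_def)
qed

text \<open>The pinch map is invariant under the half turn in the plane of the coordinates \<open>0\<close> and \<open>n\<close>,
  which exchanges the hemispheres.\<close>

lemma h_lower:
  assumes "x \<in> sphere_points n" "x n \<le> 0"
  shows "h (x(0 := - x 0)) = f (sphere_pinch n x)"
proof -
  have "(\<Sum>i<n. ((x(0 := - x 0)) i)\<^sup>2) = (\<Sum>i<n. (x i)\<^sup>2)"
    by (rule sum.cong) auto
  then have "height n (x(0 := - x 0)) = - x n"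
    using assms by (simp add: height_def sphere_disc)
  then have "sphere_pinch n (disc_lift n (x(0 := - x 0))) = sphere_pinch n x"
    using n assms(2) by (auto simp: sphere_pinch_def disc_lift_def fun_eq_iff)
  then show ?thesis
    by (simp add: disc_map_def)
qed

text \<open>Transport along these values of \<open>h\<close> is the lift \<open>S\<close>.
  Coordinate \<open>0\<close> starts at \<open>-1\<close> because that point is outside the open
  disc, where \<open>h\<close> is the base point.\<close>

definition disc_path :: "nat \<Rightarrow> real \<Rightarrow> (nat \<Rightarrow> real) \<Rightarrow> nat \<Rightarrow> (nat \<Rightarrow> real)"
  where "disc_path m a d j = h (d(0 := -1 + real j / real m * (a + 1)))"

lemma continuous_on_disc_path:
  assumes a: "continuous_on S a" and d: "continuous_on S d"
  shows "continuous_on S (\<lambda>x. disc_path m (a x) (d x) j)"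
proof -
  have "continuous_on S (\<lambda>x. -1 + real j / real m * (a x + 1))"
    by (intro continuous_intros a)
  then show ?thesis
    unfolding disc_path_def by (intro continuous_on_h continuous_on_fun_upd d)
qed

lemma sum_upd_0: "(\<Sum>i<n. ((d(0 := t)) i)\<^sup>2) = t\<^sup>2 + (\<Sum>i=1..<n. (d i)\<^sup>2)" for d :: "nat \<Rightarrow> real"
proof -
  have "(\<Sum>i<n. ((d(0 := t)) i)\<^sup>2) = t\<^sup>2 + (\<Sum>i=1..<n. ((d(0 := t)) i)\<^sup>2)"
    using n by (simp add: lessThan_atLeast0 sum.atLeast_Suc_lessThan)
  also have "(\<Sum>i=1..<n. ((d(0 := t)) i)\<^sup>2) = (\<Sum>i=1..<n. (d i)\<^sup>2)"
    by (rule sum.cong) auto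
  finally show ?thesis .
qed

lemma h_upd_outside: "1 \<le> t\<^sup>2 + (\<Sum>i=1..<n. (d i)\<^sup>2) \<Longrightarrow> h (d(0 := t)) = sphere_base"
  by (rule h_outside) (simp only: sum_upd_0)

lemma disc_path_0: "disc_path m a d 0 = sphere_base"
  unfolding disc_path_def by (rule h_upd_outside) (simp add: sum_nonneg)

lemma disc_path_end: "m > 0 \<Longrightarrow> disc_path m a d m = h (d(0 := a))"
  by (simp add: disc_path_def)

text \<open>The points between \<open>-1\<close> and \<open>a\<close> are at least as far from
  \<open>0\<close> as \<open>a\<close>, so the whole segment stays outside the open disc.\<close>

lemma disc_path_constant:
  assumes "j \<le> m" "-1 \<le> a" "a \<le> 0" "1 \<le> a\<^sup>2 + (\<Sum>i=1..<n. (d i)\<^sup>2)"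
  shows "disc_path m a d j = sphere_base"
proof -
  let ?t = "-1 + real j / real m * (a + 1)"
  have "real j / real m \<le> 1"
    using assms(1) by (simp add: divide_le_eq)
  then have "?t \<le> a"
    using mult_right_mono [of "real j / real m" 1 "a + 1"] assms(2) by simp
  then have "a\<^sup>2 \<le> ?t\<^sup>2"
    using assms(3) abs_le_square_iff [of a ?t] by simp
  then show ?thesis
    unfolding disc_path_def using assms(4) by (intro h_upd_outside) simp
qed

text \<open>Uniform continuity on a compact box yields one number of steps for all paths, as needed
  for a lift that varies continuously. The bound \<open>2\<close> leaves room for
  \<open>swell\<close>.\<close>

lemma fine_path_exists:
  obtains m where "m > 0"
    "\<And>a d. a \<in> {-2..2} \<Longrightarrow> (\<And>i. d i \<in> {-2..2}) \<Longrightarrow> broken_path k m (disc_path m a d)"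
proof -
  \<comment> \<open>\<open>\<psi>\<close> is \<open>1\<close> when its two real parameters agree, so
    a variation below \<open>1\<close> excludes the antipodal value \<open>-1\<close>.\<close>
  define \<psi> where "\<psi> z = dot k (h ((snd (snd z))(0 := fst z))) (h ((snd (snd z))(0 := fst (snd z))))"
    for z :: "real \<times> real \<times> (nat \<Rightarrow> real)"
  \<comment> \<open>For \<open>a\<close> in \<open>[-2, 2]\<close> the intermediate parameters lie
    in \<open>[-4, 4]\<close>, and consecutive ones differ by at most \<open>3 / m\<close>.\<close>
  define K where "K = {-4..4::real} \<times> {-4..4::real} \<times> {d :: nat \<Rightarrow> real. \<forall>i. d i \<in> {-2..2}}"
  have "compact K"
    unfolding K_def by (intro compact_Times compact_Icc compact_cube)
  moreover have "continuous_on K \<psi>"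
    unfolding \<psi>_def by (intro continuous_on_dot continuous_on_h continuous_on_fun_upd
        continuous_on_fst continuous_on_snd continuous_on_id)
  ultimately have "uniformly_continuous_on K \<psi>"
    by (rule compact_uniformly_continuous [rotated])
  then obtain \<delta> where \<delta>: "\<delta> > 0"
    "\<And>z z'. z \<in> K \<Longrightarrow> z' \<in> K \<Longrightarrow> dist z' z < \<delta> \<Longrightarrow> dist (\<psi> z') (\<psi> z) < 1"
    using zero_less_one unfolding uniformly_continuous_on_def by blast
  obtain m0 where m0: "3 / \<delta> < real m0"
    using reals_Archimedean2 by blast
  define m where "m = Suc m0"
  have m: "m > 0" "3 / real m < \<delta>"
    using m0 \<delta>(1) by (auto simp: m_def field_simps intro: less_trans)
  have "broken_path k m (disc_path m a d)" if a: "a \<in> {-2..2}" and d: "\<And>i. d i \<in> {-2..2}" for a d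
    unfolding broken_path_def
  proof (intro conjI allI impI)
    show "disc_path m a d j \<in> sphere_points k" for j
      by (simp add: disc_path_def h_sphere)
    fix j assume j: "j < m"
    let ?t = "\<lambda>j. -1 + real j / real m * (a + 1)"
    have t: "?t j \<in> {-4..4}" if "j \<le> m" for j
    proof -
      have "\<bar>real j / real m * (a + 1)\<bar> \<le> 1 * 3"
        unfolding abs_mult using that a by (intro mult_mono) (auto simp: divide_le_eq)
      then show ?thesis
        unfolding abs_le_iff atLeastAtMost_iff by linarith
    qed
    have "?t (Suc j) - ?t j = (a + 1) / real m"
      using m(1) by (simp add: field_simps)
    moreover have "\<bar>a + 1\<bar> \<le> 3"
      using a by auto
    then have "\<bar>(a + 1) / real m\<bar> \<le> 3 / real m"
      by (simp add: divide_right_mono)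
    ultimately have "dist (?t j, ?t (Suc j), d) (?t j, ?t j, d) < \<delta>"
      using m(2) by (simp add: dist_Pair_Pair dist_real_def)
    then have "dist (\<psi> (?t j, ?t (Suc j), d)) (\<psi> (?t j, ?t j, d)) < 1"
      using t [of j] t [of "Suc j"] d j by (intro \<delta>(2)) (auto simp: K_def)
    then show "dot k (disc_path m a d j) (disc_path m a d (Suc j)) \<noteq> -1"
      by (auto simp: disc_path_def dist_real_def \<psi>_def)
  qed
  then show ?thesis
    using that m(1) by blast
qed

end

section \<open>The model map assembled from half turns\<close>

locale fine_sphere_map = sphere_map +
  fixes m :: nat
  assumes m: "m > 0"
    and fine: "\<And>a d. a \<in> {-2..2} \<Longrightarrow> (\<And>i. d i \<in> {-2..2}) \<Longrightarrow> broken_path k m (disc_path m a d)"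
    and odd_k: "odd k"
begin

lemma disc_path_broken:
  assumes "a \<in> {-1..1}" "x \<in> sphere_points n"
  shows "broken_path k m (disc_path m a x)"
proof (rule fine)
  show "x i \<in> {-2..2}" for i
    using sphere_points_bounded [OF assms(2), of i] by (auto simp: abs_le_iff)
qed (use assms in auto)

text \<open>On the collar \<open>0 \<le> x n \<le> 1/2\<close> of the equator the map \<open>doubled\<close> is constant, while the frame
  returns along the paths to the identity and is rotated to \<open>-1\<close>.\<close>

definition swell :: "(nat \<Rightarrow> real) \<Rightarrow> (nat \<Rightarrow> real)"
  where "swell x = (\<lambda>i. x i * (1 + max (x n) 0))"

text \<open>A cutoff from \<open>1\<close> on the lower hemisphere to \<open>0\<close> at height
  \<open>1/2\<close>; it drives both the retreat of the path and the rotation to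
  \<open>-1\<close>.\<close>

definition fade :: "(nat \<Rightarrow> real) \<Rightarrow> real"
  where "fade x = max 0 (min 1 (1 - 2 * x n))"

definition target :: "(nat \<Rightarrow> real) \<Rightarrow> real"
  where "target x = -1 + fade x * (x 0 + 1)"

text \<open>This is \<open>z\<close> of the outline. Its value is \<open>h (swell x)\<close>, but it
  is written as a transport of the base point to be visibly approximable.\<close>

definition doubled :: "(nat \<Rightarrow> real) \<Rightarrow> (nat \<Rightarrow> real)"
  where "doubled x = transport k (disc_path m (swell x 0) (swell x)) m sphere_base"

text \<open>This is \<open>p = T e\<close>, where \<open>T\<close> is the complex rotation followed
  by transport; \<open>frame_inverse\<close> is the inverse of \<open>T\<close>.\<close>

definition frame_base :: "(nat \<Rightarrow> real) \<Rightarrow> (nat \<Rightarrow> real)"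
  where "frame_base x = transport k (disc_path m (target x) x) m
    (complex_rotation (fade x) (1 - fade x) sphere_base)"

definition frame_inverse :: "(nat \<Rightarrow> real) \<Rightarrow> (nat \<Rightarrow> real) \<Rightarrow> (nat \<Rightarrow> real)"
  where "frame_inverse x v = complex_rotation (fade x) (- (1 - fade x))
    (transport_back k (disc_path m (target x) x) m v)"

text \<open>The last two half turns of \<open>model\<close> must cancel below. Above, the first is
  to take effect and the second to fix its result \<open>h (swell x)\<close>.\<close>

definition correction :: "(nat \<Rightarrow> real) \<Rightarrow> (nat \<Rightarrow> real)"
  where "correction x = (if x n \<le> 0 then sphere_base else h (swell x))"

definition model :: "(nat \<Rightarrow> real) \<Rightarrow> (nat \<Rightarrow> real)"
  where "model x = half_turn k (correction x) (half_turn k sphere_base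
    (frame_inverse x (difference k (doubled x) (frame_base x))))"

lemma swell_bounded: "x \<in> sphere_points n \<Longrightarrow> swell x i \<in> {-2..2}"
proof -
  assume x: "x \<in> sphere_points n"
  have "\<bar>x i * (1 + max (x n) 0)\<bar> \<le> 1 * 2"
    unfolding abs_mult using sphere_points_bounded [OF x, of i] sphere_points_bounded [OF x, of n]
    by (intro mult_mono) auto
  then show ?thesis
    by (auto simp: swell_def)
qed

lemma swell_broken: "x \<in> sphere_points n \<Longrightarrow> broken_path k m (disc_path m (swell x 0) (swell x))"
  using swell_bounded by (intro fine)

lemma fade_bounds: "0 \<le> fade x" "fade x \<le> 1"
  by (auto simp: fade_def)

lemma target_bounds: "x \<in> sphere_points n \<Longrightarrow> target x \<in> {-1..1}"
proof -
  assume x: "x \<in> sphere_points n"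
  have "0 \<le> fade x * (x 0 + 1)" "fade x * (x 0 + 1) \<le> 1 * 2"
    using fade_bounds [of x] sphere_points_bounded [OF x, of 0]
    by (intro mult_nonneg_nonneg mult_mono; simp add: abs_le_iff)+
  then show ?thesis
    by (auto simp: target_def)
qed

lemma target_broken: "x \<in> sphere_points n \<Longrightarrow> broken_path k m (disc_path m (target x) x)"
  by (intro disc_path_broken target_bounds)

lemma fade_squares: "(fade x)\<^sup>2 + (1 - fade x)\<^sup>2 \<noteq> 0"
  by (auto simp: sum_power2_eq_zero_iff)

lemma doubled_eq: "x \<in> sphere_points n \<Longrightarrow> doubled x = h (swell x)"
  using transport_start [OF swell_broken, of x] m
  by (simp add: doubled_def disc_path_0 disc_path_end)

text \<open>At heights \<open>t\<close> up to \<open>1/2\<close> the swollen point has left the open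
  disc, since \<open>(1 - t^2) (1 + t)^2\<close> is at least \<open>1\<close> there.\<close>

lemma swell_collar:
  assumes x: "x \<in> sphere_points n" and "0 \<le> x n" "x n \<le> 1 / 2"
  shows "h (swell x) = sphere_base"
proof (rule h_outside)
  let ?t = "x n"
  have "(\<Sum>i<n. (swell x i)\<^sup>2) = (1 - ?t\<^sup>2) * (1 + ?t)\<^sup>2"
    using assms by (simp add: swell_def power_mult_distrib sphere_disc flip: sum_distrib_right)
  also have "\<dots> = 1 + ?t * (2 - 2 * ?t\<^sup>2 - ?t ^ 3)"
    by (simp add: power2_eq_square power3_eq_cube algebra_simps)
  finally have *: "(\<Sum>i<n. (swell x i)\<^sup>2) = 1 + ?t * (2 - 2 * ?t\<^sup>2 - ?t ^ 3)" .
  have "?t\<^sup>2 \<le> (1 / 2)\<^sup>2" "?t ^ 3 \<le> (1 / 2) ^ 3"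
    using assms by (intro power_mono; simp)+
  then have "0 \<le> 2 - 2 * ?t\<^sup>2 - ?t ^ 3"
    by (simp add: power2_eq_square power3_eq_cube)
  then show "1 \<le> (\<Sum>i<n. (swell x i)\<^sup>2)"
    unfolding * using assms by simp
qed

lemma lower_values:
  assumes "x n \<le> 0"
  shows "swell x = x" "fade x = 1" "target x = x 0"
  using assms by (auto simp: swell_def fade_def target_def fun_eq_iff max_def)

lemma frame_base_lower:
  assumes "x \<in> sphere_points n" "x n \<le> 0"
  shows "frame_base x = h x"
  using transport_start [OF target_broken [OF assms(1)]] m
  by (simp add: frame_base_def lower_values assms disc_path_0 disc_path_end)

lemma disc_path_minus_1: "j \<le> m \<Longrightarrow> disc_path m (-1) x j = sphere_base"
  by (rule disc_path_constant) (auto simp: sum_nonneg)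

text \<open>Here \<open>fade\<close> is \<open>0\<close>: the path has shrunk to its starting point
  and transports trivially, and the complex rotation is \<open>-1\<close>.\<close>

lemma inner_values:
  assumes "1 / 2 \<le> x n"
  shows "frame_base x = (\<lambda>i. - sphere_base i)" "frame_inverse x v = (\<lambda>i. - v i)"
proof -
  have "fade x = 0"
    using assms by (simp add: fade_def)
  moreover from this have "target x = -1"
    by (simp add: target_def)
  ultimately show "frame_base x = (\<lambda>i. - sphere_base i)" "frame_inverse x v = (\<lambda>i. - v i)"
    using transport_constant [OF sphere_base_in_nsphere disc_path_minus_1]
    by (simp_all add: frame_base_def frame_inverse_def)
qed

text \<open>Below, both arguments of \<open>difference\<close> coincide; on the collar the first is
  the base point; further up the second is its antipode.\<close>

lemma difference_defined:
  assumes x: "x \<in> sphere_points n"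
  shows "\<not> (doubled x 0 = -1 \<and> frame_base x 0 = 1)"
proof -
  consider "x n \<le> 0" | "0 \<le> x n" "x n \<le> 1 / 2" | "1 / 2 \<le> x n"
    by linarith
  then show ?thesis
  proof cases
    case 1
    then show ?thesis
      using x by (simp add: doubled_eq frame_base_lower lower_values)
  next
    case 2
    then show ?thesis
      using x by (simp add: doubled_eq swell_collar)
  next
    case 3
    then show ?thesis
      by (simp add: inner_values)
  qed
qed

lemma model_lower:
  assumes x: "x \<in> sphere_points n" and "x n \<le> 0"
  shows "model x = transport_back k (disc_path m (x 0) x) m (difference k (h x) (h x))"
  using assms half_turn_half_turn [of k sphere_base]
  by (simp add: model_def correction_def frame_inverse_def doubled_eq frame_base_lower lower_values)

lemma model_upper:
  assumes x: "x \<in> sphere_points n" and "0 \<le> x n"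
  shows "model x = h (swell x)"
proof -
  have correction: "correction x = h (swell x)"
    using assms swell_collar [OF x] by (auto simp: correction_def)
  show ?thesis
  proof (cases "x n \<le> 1 / 2")
    case True
    then have base: "h (swell x) = sphere_base"
      using assms by (intro swell_collar)
    \<comment> \<open>On the collar \<open>difference\<close> returns \<open>T e\<close> itself,
      which \<open>T^-1\<close> takes back to the base point.\<close>
    have "frame_inverse x (frame_base x) = sphere_base"
      unfolding frame_inverse_def frame_base_def
      using transport_back_transport [OF target_broken [OF x]] complex_rotation_inverse [OF fade_squares]
      by simp
    then show ?thesis
      using x by (simp add: model_def correction doubled_eq base difference_base_left half_turn_self)
  next
    case False
    \<comment> \<open>The negated reflection of \<open>h (swell x)\<close> is its half turn about
      the base point, which the next half turn undoes.\<close>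
    have "half_turn k sphere_base (\<lambda>i. - (h (swell x) i - 2 * h (swell x) 0 * sphere_base i)) = h (swell x)"
      by (simp add: half_turn_def dot_simps)
    then show ?thesis
      using x False
      by (simp add: model_def correction inner_values doubled_eq difference_antipode_right half_turn_self)
  qed
qed

lemma continuous_on_swell: "continuous_on S swell"
  unfolding swell_def by (intro continuous_on_coordinatewise_then_product continuous_intros)

lemma continuous_on_fade: "continuous_on S fade"
  unfolding fade_def by (intro continuous_intros)

lemma continuous_on_target: "continuous_on S target"
  unfolding target_def by (intro continuous_intros continuous_on_fade)

lemma continuous_on_correction: "continuous_on (sphere_points n) correction"
  unfolding correction_def
proof (rule continuous_on_cases_le)
  show "sphere_base = h (swell x)" if "x \<in> sphere_points n" "x n = 0" for x
    using that swell_collar by simp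
qed (intro continuous_intros continuous_on_h continuous_on_swell)+

text \<open>Starting from the constant base point, only half turns, complex rotations and
  \<open>difference\<close> with continuous data are applied.\<close>

lemma model_approximable: "regularly_approximable n k model"
proof -
  have "regularly_approximable n k doubled"
    unfolding doubled_def
    by (intro regularly_approximable_transport regularly_approximable_const sphere_base_in_nsphere
        swell_broken continuous_on_disc_path continuous_on_swell
        continuous_on_product_then_coordinatewise [OF continuous_on_swell])
  moreover have "regularly_approximable n k frame_base"
    unfolding frame_base_def
    by (intro regularly_approximable_transport regularly_approximable_complex_rotation
        regularly_approximable_const sphere_base_in_nsphere odd_k fade_squares
        target_broken continuous_on_disc_path continuous_on_target continuous_on_fade continuous_on_id
        continuous_on_diff continuous_on_const)
  ultimately have "regularly_approximable n k (\<lambda>x. difference k (doubled x) (frame_base x))"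
    by (rule regularly_approximable_difference) (rule difference_defined)
  then have "regularly_approximable n k
      (\<lambda>x. transport_back k (disc_path m (target x) x) m (difference k (doubled x) (frame_base x)))"
    by (intro regularly_approximable_transport_back target_broken continuous_on_disc_path
        continuous_on_target continuous_on_id)
  then have "regularly_approximable n k
      (\<lambda>x. frame_inverse x (difference k (doubled x) (frame_base x)))"
    unfolding frame_inverse_def
    by (intro regularly_approximable_complex_rotation odd_k continuous_on_fade continuous_on_minus
        continuous_on_diff continuous_on_const) (simp_all add: fade_squares)
  then have "regularly_approximable n k (\<lambda>x. half_turn k sphere_base
      (frame_inverse x (difference k (doubled x) (frame_base x))))"
    by (intro regularly_approximable_half_turn continuous_on_const) simp_all
  then show ?thesis
    unfolding model_def
  proof (rule regularly_approximable_half_turn [OF continuous_on_correction, rotated 2])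
    show "dot k (correction x) (correction x) \<noteq> 0" "i > k \<Longrightarrow> correction x i = 0" for x i
      using h_sphere [of "swell x"] by (auto simp: correction_def sphere_points_iff)
  qed
qed

section \<open>From the model map to the pinched map\<close>

definition deflated :: "(nat \<Rightarrow> real) \<Rightarrow> (nat \<Rightarrow> real)"
  where "deflated x = (if 0 \<le> x n then h x
    else transport_back k (disc_path m (x 0) x) m sphere_base)"

text \<open>The path starts at the base point and on the equator also ends there, and inverse
  transport takes the end to the start.\<close>

lemma transport_back_equator:
  assumes "x \<in> sphere_points n" "x n = 0"
  shows "transport_back k (disc_path m (x 0) x) m sphere_base = sphere_base"
proof -
  have "x 0 \<in> {-1..1}"
    using sphere_points_bounded [OF assms(1), of 0] by (auto simp: abs_le_iff)
  from transport_back_end [OF disc_path_broken [OF this assms(1)]] show ?thesis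
    using m h_equator [OF assms] by (simp add: disc_path_0 disc_path_end)
qed

text \<open>Below, the diagonal values of \<open>difference\<close> are contracted along great arcs
  before being transported back; above, the swelling is undone linearly.\<close>

lemma model_homotopic_deflated: "(model, deflated) \<in> pointed_homotopy n k"
proof (rule pointed_homotopy_hemispheresI [OF n, where
      A = "\<lambda>s x. transport_back k (disc_path m (x 0) x) m
        (great_arc k s (difference k (h x) (h x)) sphere_base)"
      and B = "\<lambda>s x. h (\<lambda>i. x i * (1 + (1 - s) * x n))"])
  let ?S = "{0..1::real} \<times> {x \<in> sphere_points n. x n \<le> 0}"
  let ?T = "{0..1::real} \<times> {x \<in> sphere_points n. 0 \<le> x n}"
  have snd: "continuous_on U (\<lambda>z :: real \<times> (nat \<Rightarrow> real). snd z)" for U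
    by (intro continuous_intros)
  note snd_eval = continuous_on_product_then_coordinatewise [OF snd]
  have broken: "broken_path k m (disc_path m (x 0) x)" if "x \<in> sphere_points n" for x
    using sphere_points_bounded [OF that, of 0] by (intro disc_path_broken that) (auto simp: abs_le_iff)
  have defined: "\<not> (h x 0 = -1 \<and> h x 0 = 1)" for x
    by simp
  have nonantipodal: "dot k (difference k (h x) (h x)) sphere_base \<noteq> -1" for x
    using difference_diagonal_ne_antipode [OF h_sphere] by simp
  show "continuous_on ?S (\<lambda>z. transport_back k (disc_path m (snd z 0) (snd z)) m
      (great_arc k (fst z) (difference k (h (snd z)) (h (snd z))) sphere_base))"
    by (intro continuous_on_transport_back continuous_on_disc_path snd snd_eval
        continuous_on_great_arc continuous_on_difference continuous_on_h continuous_on_const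
        continuous_on_fst continuous_on_id)
      (use broken h_sphere nonantipodal difference_in_sphere [OF h_sphere h_sphere defined]
        sphere_base_in_nsphere in auto)
  show "continuous_on ?T (\<lambda>z. h (\<lambda>i. snd z i * (1 + (1 - fst z) * snd z n)))"
    by (intro continuous_on_h continuous_on_coordinatewise_then_product continuous_on_mult
        continuous_on_add continuous_on_diff continuous_on_const continuous_on_fst continuous_on_id
        snd_eval)
  show "transport_back k (disc_path m (x 0) x) m
      (great_arc k s (difference k (h x) (h x)) sphere_base) \<in> sphere_points k"
    if "s \<in> {0..1}" "x \<in> sphere_points n" for s x
    by (intro transport_back_in_sphere broken great_arc_in_sphere difference_in_sphere h_sphere
        defined nonantipodal sphere_base_in_nsphere that)
  show "transport_back k (disc_path m (x 0) x) m
      (great_arc k s (difference k (h x) (h x)) sphere_base) = sphere_base \<and>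
      h (\<lambda>i. x i * (1 + (1 - s) * x n)) = sphere_base"
    if "x \<in> sphere_points n" "x n = 0" for s x
    using that h_equator transport_back_equator
    by (simp add: difference_base_left great_arc_same [OF sphere_base_in_nsphere])
  show "model x = transport_back k (disc_path m (x 0) x) m
      (great_arc k 0 (difference k (h x) (h x)) sphere_base)"
    if "x \<in> sphere_points n" "x n \<le> 0" for x
    using that by (simp add: model_lower)
  show "model x = h (\<lambda>i. x i * (1 + (1 - 0) * x n))" if "x \<in> sphere_points n" "0 \<le> x n" for x
    using that by (simp add: model_upper swell_def)
  show "deflated x = transport_back k (disc_path m (x 0) x) m
      (great_arc k 1 (difference k (h x) (h x)) sphere_base)"
    if "x \<in> sphere_points n" "x n \<le> 0" for x
    using that by (auto simp: deflated_def h_equator transport_back_equator)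
  show "deflated x = h (\<lambda>i. x i * (1 + (1 - 1) * x n))" if "x \<in> sphere_points n" "0 \<le> x n" for x
    using that by (simp add: deflated_def)
qed (use h_sphere in auto)

text \<open>Half the length of the chord of the disc through \<open>x\<close> in the direction of
  coordinate \<open>0\<close>.\<close>

definition half_width :: "(nat \<Rightarrow> real) \<Rightarrow> real"
  where "half_width x = sqrt (1 - (\<Sum>i=1..<n. (x i)\<^sup>2))"

lemma sphere_split: "x \<in> sphere_points n \<Longrightarrow> (x 0)\<^sup>2 + (\<Sum>i=1..<n. (x i)\<^sup>2) = 1 - (x n)\<^sup>2"
  using n sphere_disc [of x n] by (simp add: lessThan_atLeast0 sum.atLeast_Suc_lessThan)

lemma half_width:
  assumes "x \<in> sphere_points n"
  shows "(half_width x)\<^sup>2 + (\<Sum>i=1..<n. (x i)\<^sup>2) = 1" "\<bar>x 0\<bar> \<le> half_width x"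
    "0 \<le> half_width x" "half_width x \<le> 1" "x n = 0 \<Longrightarrow> \<bar>x 0\<bar> = half_width x"
proof -
  have "(x 0)\<^sup>2 \<le> 1 - (\<Sum>i=1..<n. (x i)\<^sup>2)"
    using sphere_split [OF assms] zero_le_power2 [of "x n"] by linarith
  then have "0 \<le> 1 - (\<Sum>i=1..<n. (x i)\<^sup>2)"
    using zero_le_power2 order_trans by blast
  then show 1: "(half_width x)\<^sup>2 + (\<Sum>i=1..<n. (x i)\<^sup>2) = 1" "0 \<le> half_width x"
    by (simp_all add: half_width_def)
  show "\<bar>x 0\<bar> \<le> half_width x"
    using \<open>(x 0)\<^sup>2 \<le> 1 - (\<Sum>i=1..<n. (x i)\<^sup>2)\<close> unfolding half_width_def
    by (metis real_sqrt_abs real_sqrt_le_mono)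
  show "half_width x \<le> 1"
    by (simp add: half_width_def sum_nonneg)
  show "\<bar>x 0\<bar> = half_width x" if "x n = 0"
  proof -
    have "1 - (\<Sum>i=1..<n. (x i)\<^sup>2) = (x 0)\<^sup>2"
      using sphere_split [OF assms] that by simp
    then have "half_width x = sqrt ((x 0)\<^sup>2)"
      unfolding half_width_def by (rule arg_cong)
    then show ?thesis
      by simp
  qed
qed

text \<open>With \<open>S(a)\<close> the transport along the segment from \<open>(-1, x')\<close> to \<open>(a, x')\<close>, the homotopy is
  \<open>S(p)^-1 h(q)\<close>, which is the base point for \<open>p = q\<close>; this is the Eckmann-Hilton argument
  comparing the inverse in the group of rotations with the reversed path.\<close>

lemma deflated_homotopic_pinch: "(deflated, \<lambda>x. f (sphere_pinch n x)) \<in> pointed_homotopy n k"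
proof (rule pointed_homotopy_hemispheresI [OF n, where
      A = "\<lambda>s x. transport_back k (disc_path m ((1 - s) * x 0 - s * half_width x) x) m
        (h (x(0 := (1 - s) * half_width x - s * x 0)))"
      and B = "\<lambda>s x. h x"])
  let ?S = "{0..1::real} \<times> {x \<in> sphere_points n. x n \<le> 0}"
  let ?T = "{0..1::real} \<times> {x \<in> sphere_points n. 0 \<le> x n}"
  have snd: "continuous_on U (\<lambda>z :: real \<times> (nat \<Rightarrow> real). snd z)" for U
    by (intro continuous_intros)
  note snd_eval = continuous_on_product_then_coordinatewise [OF snd]
  have half_width_snd: "continuous_on U (\<lambda>z :: real \<times> (nat \<Rightarrow> real). half_width (snd z))" for U
    unfolding half_width_def
    by (intro continuous_on_real_sqrt continuous_on_diff continuous_on_const continuous_on_sum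
        continuous_on_power snd_eval)
  have start: "(1 - s) * x 0 - s * half_width x \<in> {-1..1}"
    if "s \<in> {0..1}" "x \<in> sphere_points n" for s x
  proof -
    have "\<bar>(1 - s) * x 0 - s * half_width x\<bar> \<le> \<bar>(1 - s) * x 0\<bar> + \<bar>s * half_width x\<bar>"
      by (rule abs_triangle_ineq4)
    also have "\<dots> \<le> (1 - s) * 1 + s * 1"
      unfolding abs_mult using that half_width [OF that(2)] sphere_points_bounded [OF that(2), of 0]
      by (intro add_mono mult_mono) auto
    finally show ?thesis
      by (auto simp: abs_le_iff)
  qed
  show "continuous_on ?S (\<lambda>z. transport_back k
      (disc_path m ((1 - fst z) * snd z 0 - fst z * half_width (snd z)) (snd z)) m
      (h ((snd z)(0 := (1 - fst z) * half_width (snd z) - fst z * snd z 0))))"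
    by (intro continuous_on_transport_back continuous_on_disc_path continuous_on_h
        continuous_on_fun_upd continuous_on_diff continuous_on_mult continuous_on_const
        continuous_on_fst continuous_on_id snd snd_eval half_width_snd)
      (use start disc_path_broken in auto)
  show "continuous_on ?T (\<lambda>z. h (snd z))"
    by (intro continuous_on_h snd)
  show "transport_back k (disc_path m ((1 - s) * x 0 - s * half_width x) x) m
        (h (x(0 := (1 - s) * half_width x - s * x 0))) \<in> sphere_points k"
    if "s \<in> {0..1}" "x \<in> sphere_points n" for s x
    by (intro transport_back_in_sphere disc_path_broken start that h_sphere)
  \<comment> \<open>The segment up to the left end of the chord lies outside the open disc, so its
    transport is trivial.\<close>
  have left: "transport_back k (disc_path m (- half_width x) x) m v = v"
    if "x \<in> sphere_points n" for x v
    using half_width [OF that]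
    by (intro transport_constant(2) [OF sphere_base_in_nsphere] disc_path_constant) auto
  have right: "h (x(0 := half_width x)) = sphere_base" if "x \<in> sphere_points n" for x
    using half_width(1) [OF that] by (intro h_upd_outside) simp
  \<comment> \<open>An equator point is an end of its chord. At the left end \<open>p\<close> and
    \<open>q\<close> remain at opposite ends; at the right end \<open>p = q\<close>
    throughout.\<close>
  show "transport_back k (disc_path m ((1 - s) * x 0 - s * half_width x) x) m
        (h (x(0 := (1 - s) * half_width x - s * x 0))) = sphere_base \<and> h x = sphere_base"
    if s: "s \<in> {0..1}" and x: "x \<in> sphere_points n" "x n = 0" for s x
  proof (cases "x 0 \<le> 0")
    case True
    then have x0: "x 0 = - half_width x"
      using half_width(5) [OF x] by simp
    have "(1 - s) * x 0 - s * half_width x = - half_width x"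
      "(1 - s) * half_width x - s * x 0 = half_width x"
      unfolding x0 by (simp_all add: algebra_simps)
    then show ?thesis
      using left right h_equator x by simp
  next
    case False
    then have x0: "half_width x = x 0"
      using half_width(5) [OF x] by simp
    from transport_back_end [OF disc_path_broken [OF start [OF s x(1)] x(1)]] show ?thesis
      using m h_equator [OF x] by (simp add: x0 disc_path_0 disc_path_end)
  qed
  show "deflated x = transport_back k (disc_path m ((1 - 0) * x 0 - 0 * half_width x) x) m
        (h (x(0 := (1 - 0) * half_width x - 0 * x 0)))"
    if "x \<in> sphere_points n" "x n \<le> 0" for x
    using that right by (auto simp: deflated_def h_equator transport_back_equator)
  \<comment> \<open>At the final time the transport is trivial, and what remains is \<open>h\<close>
    at the point with coordinate \<open>0\<close> reversed.\<close>
  show "f (sphere_pinch n x) = transport_back k (disc_path m ((1 - 1) * x 0 - 1 * half_width x) x) m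
        (h (x(0 := (1 - 1) * half_width x - 1 * x 0)))"
    if "x \<in> sphere_points n" "x n \<le> 0" for x
    using that left h_lower by simp
  show "f (sphere_pinch n x) = h x" if "x \<in> sphere_points n" "0 \<le> x n" for x
    using that by (simp add: h_upper)
qed (use h_sphere in \<open>auto simp: deflated_def\<close>)

lemma pinch_homotopic_regular:
  obtains g where "regular_map (Suc n) (sphere_points n) (Suc k) (sphere_points k) g"
    "(\<lambda>x. f (sphere_pinch n x), g) \<in> pointed_homotopy n k"
proof -
  have "model sphere_base = sphere_base"
    using model_homotopic_deflated equiv_pointed_homotopy
    by (auto simp: pointed_homotopy_def dest: homotopic_with_imp_property)
  then obtain g where g: "regular_map (Suc n) (sphere_points n) (Suc k) (sphere_points k) g"
      "(model, g) \<in> pointed_homotopy n k"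
    using regularly_approximable_imp_homotopic [OF model_approximable] by blast
  have "(\<lambda>x. f (sphere_pinch n x), g) \<in> pointed_homotopy n k"
    using model_homotopic_deflated deflated_homotopic_pinch g(2)
    by (meson pointed_homotopy_sym pointed_homotopy_trans)
  then show ?thesis
    using g(1) that by blast
qed

end

theorem theorem1p4:
  fixes k n :: nat
  assumes "k > 0" and "odd k" and "n > 0"
  shows "twice_homotopy_classes n k \<subseteq> algebraic_homotopy_classes n k"
proof
  fix \<beta> assume "\<beta> \<in> twice_homotopy_classes n k"
  then obtain \<alpha> where \<alpha>: "\<alpha> \<in> homotopy_classes n k" "\<beta> = homotopy_class_add n k \<alpha> \<alpha>"
    by (auto simp: twice_homotopy_classes_def)
  obtain f where f: "f \<in> pointed_sphere_maps n k" "\<alpha> = pointed_homotopy n k `` {f}"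
    using \<alpha>(1) unfolding homotopy_classes_def by (auto elim!: quotientE)
  have "continuous_map (top_of_set (sphere_points n)) (top_of_set (sphere_points k)) f"
    using f(1) by (simp add: pointed_sphere_maps_def nsphere_eq_top_of_set [symmetric])
  then interpret sphere_map n k f
    using f(1) assms(3) by unfold_locales (auto simp: pointed_sphere_maps_def)
  obtain m where m: "m > 0"
    "\<And>a d. a \<in> {-2..2} \<Longrightarrow> (\<And>i. d i \<in> {-2..2}) \<Longrightarrow> broken_path k m (disc_path m a d)"
    using fine_path_exists by blast
  interpret fine_sphere_map n k f m
  proof
    show "broken_path k m (disc_path m a d)" if "a \<in> {-2..2}" "\<And>i. d i \<in> {-2..2}" for a d
      using that by (rule m(2))
  qed (fact m(1) assms(2))+
  obtain g where g: "regular_map (Suc n) (sphere_points n) (Suc k) (sphere_points k) g"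
      "(\<lambda>x. f (sphere_pinch n x), g) \<in> pointed_homotopy n k"
    by (rule pinch_homotopic_regular)
  \<comment> \<open>With equal summands both branches of \<open>sphere_map_add\<close> agree, so
    \<open>f\<close> after the pinch map represents the double.\<close>
  have "\<beta> = pointed_homotopy n k `` {\<lambda>x. f (sphere_pinch n x)}"
    using homotopy_class_add_eq [OF assms(3) f(1) f(1)] \<alpha>(2) f(2)
    by (simp add: sphere_map_add_def)
  moreover have "\<beta> \<in> homotopy_classes n k"
    using homotopy_class_add_closed [OF assms(3) \<alpha>(1) \<alpha>(1)] \<alpha>(2) by simp
  ultimately show "\<beta> \<in> algebraic_homotopy_classes n k"
    using g by (auto simp: algebraic_homotopy_classes_def)
qed

end
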